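(* Let $\mathcal X$ be a class of compact metric spaces that admit, for each $\epsilon>0$, $\epsilon$-retractions onto polyhedra. Then: (1) the product of countably many (finitely or infinitely many) spaces from $\mathcal X$ belongs to $0\text{-}CR$; (2) the cone over $X$ and the suspension over $X$ belong to $0\text{-}CR$ for each $X\in\mathcal X$.
   Context: A polyhedron is a space homeomorphic to the union of the simplices of a finite simplicial complex. For a compact metric space $(X,d)$ and $\epsilon>0$, an $\epsilon$-retraction of $X$ onto a subspace $Y\subset X$ is a continuous $r:X\to Y$ with $r(y)=y$ for $y\in Y$ and $\sup_{x\in X}d(r(x),x)<\epsilon$. The cone over $X$ is $(X\times[0,1])/(X\times\{1\})$; the suspension is obtained from $X\times[-1,1]$ by collapsing each of $X\times\{1\}$ and $X\times\{-1\}$ to a point. $C(X,X)$ is the space of continuous self-maps of $X$ with the topology of uniform convergence. For $f\in C(X,X)$ and $\epsilon>0$, an $\epsilon$-chain for $f$ from $x$ to $y$ is a finite sequence $x=x_0,x_1,\dots,x_n=y$ ($n\ge 1$) in $X$ with $d(f(x_{i-1}),x_i)<\epsilon$ for $i=1,\dots,n$. A point $x$ is chain recurrent for $f$ if for each $\epsilon>0$ there is an $\epsilon$-chain for $f$ from $x$ to $x$; $CR(f)$ is the set of chain recurrent points of $f$. A property holds for a generic $f\in C(X,X)$ if the set of maps having it is residual, i.e. contains a dense $G_\delta$-subset of $C(X,X)$. The class $0\text{-}CR$ consists of all compact metric spaces $X$ such that $CR(f)$ is $0$-dimensional for a generic $f\in C(X,X)$. *)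

theory Defs
  imports "HOL-Analysis.Analysis"
begin

section \<open>Polyhedra and retractions\<close>

text \<open>
  A finite simplicial complex is given by its vertices, which are natural numbers, and its faces;
  vertex \<open>i\<close> sits at the \<open>i\<close>-th unit vector of the space of real sequences, and only
  finitely many coordinates are used.  The library's \<open>simplicial_complex\<close> lives in a
  \<open>euclidean_space\<close> type, so it would bound the dimension of all polyhedra at once by the
  dimension of that type; here the dimension is finite but unbounded.
\<close>

definition face_simplex :: "nat set \<Rightarrow> (nat \<Rightarrow> real) set" where
  "face_simplex s = {t. (\<forall>i. 0 \<le> t i) \<and> (\<forall>i. i \<notin> s \<longrightarrow> t i = 0) \<and> (\<Sum>i\<in>s. t i) = 1}"

definition finite_simplicial_complex :: "nat set set \<Rightarrow> bool" where
  "finite_simplicial_complex K \<longleftrightarrow>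
     finite K \<and> (\<forall>s\<in>K. finite s) \<and> (\<forall>s\<in>K. \<forall>t\<subseteq>s. t \<noteq> {} \<longrightarrow> t \<in> K)"

definition polyhedron_space :: "'a topology \<Rightarrow> bool" where
  "polyhedron_space X \<longleftrightarrow>
     (\<exists>K. finite_simplicial_complex K \<and>
        X homeomorphic_space subtopology (powertop_real UNIV) (\<Union>s\<in>K. face_simplex s))"

text \<open>The supremum is taken in the extended reals, so that it is meaningful for every set.\<close>

definition eps_retraction :: "'a metric \<Rightarrow> real \<Rightarrow> 'a set \<Rightarrow> ('a \<Rightarrow> 'a) \<Rightarrow> bool" where
  "eps_retraction X \<epsilon> Y r \<longleftrightarrow>
     Y \<subseteq> mspace X \<and>
     continuous_map (mtopology_of X) (subtopology (mtopology_of X) Y) r \<and>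
     (\<forall>y\<in>Y. r y = y) \<and>
     (SUP x\<in>mspace X. ereal (mdist X (r x) x)) < ereal \<epsilon>"

definition admits_polyhedral_retractions :: "'a metric \<Rightarrow> bool" where
  "admits_polyhedral_retractions X \<longleftrightarrow>
     (\<forall>\<epsilon>>0. \<exists>Y r. polyhedron_space (subtopology (mtopology_of X) Y) \<and> eps_retraction X \<epsilon> Y r)"

section \<open>Quotient spaces, cone and suspension\<close>

definition quotient_topology :: "'a topology \<Rightarrow> ('a \<times> 'a) set \<Rightarrow> 'a set topology" where
  "quotient_topology X R = topology (\<lambda>U. U \<subseteq> topspace X // R \<and> openin X (\<Union>U))"

lemma openin_quotient_topology:
  assumes "equiv (topspace X) R"
  shows "openin (quotient_topology X R) U \<longleftrightarrow> U \<subseteq> topspace X // R \<and> openin X (\<Union>U)"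
proof -
  have inter: "\<Union>(S \<inter> T) = \<Union>S \<inter> \<Union>T"
    if "S \<subseteq> topspace X // R" "T \<subseteq> topspace X // R" for S T
    using quotient_disj[OF assms] that by blast
  have un: "\<Union>(\<Union>\<K>) = (\<Union>S\<in>\<K>. \<Union>S)" for \<K> :: "'a set set set"
    by blast
  have "istopology (\<lambda>U. U \<subseteq> topspace X // R \<and> openin X (\<Union>U))"
    unfolding istopology_def using inter by (auto simp: un)
  then show ?thesis
    unfolding quotient_topology_def by (simp add: topology_inverse')
qed

lemma topspace_quotient_topology:
  assumes "equiv (topspace X) R"
  shows "topspace (quotient_topology X R) = topspace X // R"
proof (rule subset_antisym)
  show "topspace (quotient_topology X R) \<subseteq> topspace X // R"
    using openin_quotient_topology[OF assms] openin_topspace by blast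
  have "openin (quotient_topology X R) (topspace X // R)"
    using openin_quotient_topology[OF assms] Union_quotient[OF assms] by auto
  then show "topspace X // R \<subseteq> topspace (quotient_topology X R)"
    by (rule openin_subset)
qed

lemma quotient_map_quotient_topology:
  assumes "equiv (topspace X) R"
  shows "quotient_map X (quotient_topology X R) (\<lambda>x. R `` {x})"
proof -
  have img: "(\<lambda>x. R `` {x}) ` topspace X = topspace (quotient_topology X R)"
    unfolding topspace_quotient_topology[OF assms] by (auto simp: quotient_def)
  have "{x \<in> topspace X. R `` {x} \<in> U} = \<Union>U" if U: "U \<subseteq> topspace X // R" for U
  proof (intro subset_antisym subsetI)
    fix x assume "x \<in> {x \<in> topspace X. R `` {x} \<in> U}"
    then show "x \<in> \<Union>U" using equiv_class_self[OF assms] by blast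
  next
    fix x assume "x \<in> \<Union>U"
    then obtain A where A: "A \<in> U" "x \<in> A" by blast
    then have q: "A \<in> topspace X // R" using U by blast
    then have "x \<in> topspace X" using A assms in_quotient_imp_subset by blast
    moreover have "R `` {x} = A"
      using q A by (metis assms Image_singleton_iff equiv_class_eq_iff quotientE)
    ultimately show "x \<in> {x \<in> topspace X. R `` {x} \<in> U}" using A by simp
  qed
  then show ?thesis
    unfolding quotient_map_def
    using img by (auto simp: openin_quotient_topology[OF assms] topspace_quotient_topology[OF assms])
qed

definition collapse_rel :: "'a set \<Rightarrow> 'a set set \<Rightarrow> ('a \<times> 'a) set" where
  "collapse_rel S \<A> = {(x, y). x \<in> S \<and> y \<in> S \<and> (x = y \<or> (\<exists>A\<in>\<A>. x \<in> A \<and> y \<in> A))}"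

lemma equiv_collapse_rel:
  assumes "\<And>A B. A \<in> \<A> \<Longrightarrow> B \<in> \<A> \<Longrightarrow> A \<noteq> B \<Longrightarrow> A \<inter> B = {}"
  shows "equiv S (collapse_rel S \<A>)"
proof (rule equivI)
  show "collapse_rel S \<A> \<subseteq> S \<times> S" by (auto simp: collapse_rel_def)
  show "refl_on S (collapse_rel S \<A>)" by (auto simp: refl_on_def collapse_rel_def)
  show "sym (collapse_rel S \<A>)" by (auto simp: sym_def collapse_rel_def)
  show "trans (collapse_rel S \<A>)"
    using assms unfolding trans_def collapse_rel_def by blast
qed

definition collapse_topology :: "'a topology \<Rightarrow> 'a set set \<Rightarrow> 'a set topology" where
  "collapse_topology X \<A> = quotient_topology X (collapse_rel (topspace X) \<A>)"

definition cone_topology :: "'a topology \<Rightarrow> ('a \<times> real) set topology" where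
  "cone_topology X =
     collapse_topology (prod_topology X (top_of_set {0..1})) {topspace X \<times> {1}}"

definition suspension_topology :: "'a topology \<Rightarrow> ('a \<times> real) set topology" where
  "suspension_topology X =
     collapse_topology (prod_topology X (top_of_set {-1..1}))
       {topspace X \<times> {1}, topspace X \<times> {-1}}"

section \<open>Chain recurrence\<close>

definition eps_chain ::
  "'a metric \<Rightarrow> ('a \<Rightarrow> 'a) \<Rightarrow> real \<Rightarrow> 'a \<Rightarrow> 'a \<Rightarrow> nat \<Rightarrow> (nat \<Rightarrow> 'a) \<Rightarrow> bool" where
  "eps_chain X f \<epsilon> x y n c \<longleftrightarrow>
     1 \<le> n \<and> c 0 = x \<and> c n = y \<and> (\<forall>i\<le>n. c i \<in> mspace X) \<and>
     (\<forall>i\<in>{1..n}. mdist X (f (c (i - 1))) (c i) < \<epsilon>)"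

definition CR :: "'a metric \<Rightarrow> ('a \<Rightarrow> 'a) \<Rightarrow> 'a set" where
  "CR X f = {x \<in> mspace X. \<forall>\<epsilon>>0. \<exists>n c. eps_chain X f \<epsilon> x x n c}"

text \<open>
  For a continuous self-map of a nonempty compact space \<open>CR\<close> is never empty, so that \<open>dim_le 0\<close>, which by itself
  also admits the empty set, says that \<open>CR\<close> has dimension exactly 0.
\<close>

lemma CR_nonempty:
  assumes comp: "compact_space (mtopology_of X)" and ne: "mspace X \<noteq> {}"
    and cont: "continuous_map (mtopology_of X) (mtopology_of X) f"
  shows "CR X f \<noteq> {}"
proof -
  interpret Metric_space "mspace X" "mdist X" by simp
  have top: "mtopology_of X = mtopology" by (simp add: mtopology_of_def)
  obtain x0 where x0: "x0 \<in> mspace X" using ne by blast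
  have fM: "f x \<in> mspace X" if "x \<in> mspace X" for x
    using continuous_map_funspace[OF cont] that by auto
  define orb where "orb = (\<lambda>k. (f ^^ k) x0)"
  have oM: "orb k \<in> mspace X" for k
    unfolding orb_def by (induction k) (use x0 fM in auto)
  have oS: "f (orb k) = orb (Suc k)" for k by (simp add: orb_def)
  have "range orb \<subseteq> mspace X" using oM by blast
  then obtain y r where y: "y \<in> mspace X" and r: "strict_mono r"
    and lim: "limitin mtopology (orb \<circ> r) y sequentially"
    using comp unfolding top compact_space_sequentially by blast
  have limf: "limitin mtopology (f \<circ> (orb \<circ> r)) (f y) sequentially"
    using continuous_map_limit[OF _ lim] cont unfolding top by blast
  have "\<exists>n c. eps_chain X f e y y n c" if e: "e > 0" for e
  proof -
    obtain N1 where N1: "\<And>k. k \<ge> N1 \<Longrightarrow> mdist X (orb (r k)) y < e"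
      using lim e unfolding limit_metric_sequentially o_apply by meson
    obtain N2 where N2: "\<And>k. k \<ge> N2 \<Longrightarrow> mdist X (f (orb (r k))) (f y) < e"
      using limf e unfolding limit_metric_sequentially o_apply by meson
    define k where "k = max N1 N2"
    define m where "m = k + 2"
    have "r k < r (Suc k)" "r (Suc k) < r m"
      using r by (auto simp: strict_mono_def m_def)
    then have km: "r k + 2 \<le> r m" by linarith
    define n where "n = r m - r k"
    define c where "c = (\<lambda>i. if i = 0 \<or> i = n then y else orb (r k + i))"
    have n2: "2 \<le> n" using km by (simp add: n_def)
    have "mdist X (f (c (i - 1))) (c i) < e" if i: "i \<in> {1..n}" for i
    proof -
      consider "i = 1" | "i = n" | "1 < i" "i < n" using i by fastforce
      then show ?thesis
      proof cases
        case 1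
        then have "c (i - 1) = y" "c i = f (orb (r k))"
          using n2 by (auto simp: c_def oS)
        then show ?thesis using N2[of k] commute by (simp add: k_def)
      next
        case 2
        have "c (i - 1) = orb (r k + (n - 1))" "c i = y"
          using 2 n2 by (auto simp: c_def)
        moreover have "Suc (r k + (n - 1)) = r m" using km by (simp add: n_def)
        ultimately have "f (c (i - 1)) = orb (r m)" by (simp add: oS)
        then show ?thesis using N1[of m] \<open>c i = y\<close> by (simp add: k_def m_def)
      next
        case 3
        then have "c (i - 1) = orb (r k + (i - 1))" "c i = orb (r k + i)"
          by (auto simp: c_def)
        moreover have "Suc (r k + (i - 1)) = r k + i" using 3 by simp
        ultimately have "f (c (i - 1)) = c i" by (simp add: oS)
        moreover have "c i \<in> mspace X" using oM y by (simp add: c_def)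
        ultimately show ?thesis using e by simp
      qed
    qed
    moreover have "c i \<in> mspace X" for i using oM y by (simp add: c_def)
    moreover have "c 0 = y" "c n = y" by (auto simp: c_def)
    ultimately have "eps_chain X f e y y n c"
      using n2 by (auto simp: eps_chain_def)
    then show ?thesis by blast
  qed
  then have "y \<in> CR X f" using y by (auto simp: CR_def)
  then show ?thesis by blast
qed

section \<open>Generic maps and the class 0-CR\<close>

definition residual_in :: "'a topology \<Rightarrow> 'a set \<Rightarrow> bool" where
  "residual_in T A \<longleftrightarrow>
     A \<subseteq> topspace T \<and> (\<exists>G\<subseteq>A. gdelta_in T G \<and> T closure_of G = topspace T)"

text \<open>
  \<open>cfunspace (mtopology_of X) X\<close> is the library's space of (bounded) continuous maps from
  \<open>X\<close> to itself, represented as extensional functions, with the supremum metric.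
\<close>

definition generic_map :: "'a metric \<Rightarrow> (('a \<Rightarrow> 'a) \<Rightarrow> bool) \<Rightarrow> bool" where
  "generic_map X P \<longleftrightarrow>
     residual_in (mtopology_of (cfunspace (mtopology_of X) X))
       {f \<in> mspace (cfunspace (mtopology_of X) X). P f}"

definition zero_CR :: "'a metric set" where
  "zero_CR =
     {X. compact_space (mtopology_of X) \<and>
         generic_map X (\<lambda>f. subtopology (mtopology_of X) (CR X f) dim_le 0)}"

text \<open>
  Products, cones and suspensions come with a topology but no preferred metric.  Membership of
  such a space in 0-CR is taken to mean that it is metrizable and that every compatible metric
  makes it a member.
\<close>

definition zero_CR_space :: "'a topology \<Rightarrow> bool" where
  "zero_CR_space T \<longleftrightarrow>
     metrizable_space T \<and> (\<forall>D. mtopology_of D = T \<longrightarrow> D \<in> zero_CR)"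

end

theory Submission
  imports Defs
begin

text \<open>
  All three constructions are handled by one criterion, \<open>zero_CR_of_cube_retractions\<close>.
  Suppose that arbitrarily close to the identity there are self-maps \<open>R\<close> of the compact metric
  space \<open>X\<close> that factor as \<open>j \<circ> U\<close> through a set \<open>P\<close> in some cube
  \<open>[0,1]\<^sup>V\<close>, where \<open>U \<circ> R = U\<close> and \<open>P\<close> is stable under applying to all coordinates
  a monotone function that fixes 0 and 1.  Such a \<open>P\<close> is a subcomplex of the Kuhn triangulation of every
  mesh \<open>1/m\<close>.  Then \<open>X\<close> belongs to \<open>zero_CR\<close>.

  By the Baire category theorem it is enough that every map \<open>f\<close> is approximated by maps
  \<open>g\<close> whose pseudo-orbits returning to their starting point start in a disjoint union of small
  open sets, with a tolerance that survives small perturbations of \<open>g\<close>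
  (\<open>zero_CR_of_dense_robust\<close>).  The approximation uses a cellular map with contracting skeleta.
  Take a coarse Kuhn triangulation and a fine one that subdivides it, and let \<open>\<alpha>\<close> be a
  simplicial approximation of \<open>U \<circ> f \<circ> j\<close>, a map from fine vertices to coarse vertices.  With fine
  hat functions \<open>w\<^sub>b\<close> and a small threshold \<open>\<eta>\<close>, put

  \<open>g(x) = j (\<Sum>b. c\<^sub>b(x) \<alpha>(b))\<close> with \<open>\<Sum>b. c\<^sub>b(x) = 1\<close>, where \<open>c\<^sub>b\<close> is proportional to \<open>max 0 (w\<^sub>b - \<eta>)\<close>.

  If exactly \<open>n\<close> hats exceed \<open>\<eta>\<close> at \<open>x\<close>, then \<open>U(g(x))\<close> is a convex combination of at most \<open>n\<close>
  vertices of one coarse simplex, so it lies in the coarse \<open>(n-1)\<close>-skeleton, hence in the fine one, and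
  at most \<open>n\<close> hats are positive at \<open>g(x)\<close>.  The number of hats that are at least \<open>\<eta>\<close> therefore cannot
  increase along a pseudo-orbit with small errors.  On a pseudo-orbit that closes up it is constant, and
  this forces every hat at the starting point to be either at least \<open>\<eta>\<close> or below \<open>\<eta>/2\<close>; the set of
  large hats then labels disjoint open sets of small diameter
  (\<open>robust_chain_cover_of_weights\<close>).

  Kuhn triangulations make the subdivision argument explicit.  The vertices of the simplex around
  \<open>x\<close> are the points \<open>\<lceil>x - \<theta>\<rceil>\<close> for \<open>0 \<le> \<theta> < 1\<close>, with the ceiling taken in each coordinate, and
  there are as many of them as elements in the set of fractional parts of coordinates together with 0.
  Multiplying by an integer does not increase this number.

  A finite simplicial complex embeds linearly as such a set \<open>P\<close> by tail sums of barycentric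
  coordinates, because the resulting conditions only compare coordinates with each other and with 0 and 1.
  Sets defined by such conditions are stable under finite products, and cones and suspensions of such
  embedded polyhedra have the same shape, so retractions of the factors or of the base give retractions
  of the products, cones and suspensions.
\<close>

section \<open>Uniform estimates on compact spaces\<close>

lemma mdist_self: "x \<in> mspace X \<Longrightarrow> mdist X x x = 0"
  by simp

text \<open>
  The open sets \<open>{\<Psi> < \<epsilon>}\<close> and \<open>{N i > s}\<close> with \<open>s > 0\<close> cover the space; a finite subcover
  names finitely many indices and a smallest \<open>s\<close>.  With \<open>N\<close> measuring distances this is uniform
  continuity; with an infinite index set it finds the finitely many coordinates of a product that
  control a given compatible metric.
\<close>

lemma compact_space_uniform_bound:
  fixes N :: "'i \<Rightarrow> 'a \<Rightarrow> real" and \<Psi> :: "'a \<Rightarrow> real"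
  assumes T: "compact_space T"
    and N: "\<And>i. i \<in> I \<Longrightarrow> continuous_map T euclideanreal (N i)"
    and \<Psi>: "continuous_map T euclideanreal \<Psi>"
    and small: "\<And>z. z \<in> topspace T \<Longrightarrow> (\<And>i. i \<in> I \<Longrightarrow> N i z \<le> 0) \<Longrightarrow> \<Psi> z < \<epsilon>"
  shows "\<exists>J \<sigma>. finite J \<and> J \<subseteq> I \<and> 0 < \<sigma> \<and>
    (\<forall>z\<in>topspace T. (\<forall>i\<in>J. N i z < \<sigma>) \<longrightarrow> \<Psi> z < \<epsilon>)"
proof -
  define W where "W = {z \<in> topspace T. \<Psi> z \<in> {..<\<epsilon>}}"
  define F where "F = (\<lambda>(i, s). {z \<in> topspace T. N i z \<in> {s<..}})"
  let ?U = "insert W (F ` (I \<times> {0<..}))"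
  have "openin T W" unfolding W_def
    by (rule openin_continuous_map_preimage[OF \<Psi>]) auto
  moreover have "openin T (F p)" if "p \<in> I \<times> {0<..}" for p
    using that unfolding F_def
    by (auto intro!: openin_continuous_map_preimage[OF N, of _ "{_<..}", simplified])
  ultimately have op: "\<And>U. U \<in> ?U \<Longrightarrow> openin T U" by blast
  have "topspace T \<subseteq> \<Union>?U"
  proof
    fix z assume z: "z \<in> topspace T"
    show "z \<in> \<Union>?U"
    proof (cases "\<Psi> z < \<epsilon>")
      case True
      then show ?thesis using z by (auto simp: W_def)
    next
      case False
      then obtain i where "i \<in> I" "N i z > 0" using small[OF z] by force
      then have "z \<in> F (i, N i z / 2)" "(i, N i z / 2) \<in> I \<times> {0<..}" using z by (auto simp: F_def)
      then show ?thesis by blast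
    qed
  qed
  then obtain \<F> where \<F>: "finite \<F>" "\<F> \<subseteq> ?U" "topspace T \<subseteq> \<Union>\<F>"
    using T op unfolding compact_space_alt by meson
  have "\<F> - {W} \<subseteq> F ` (I \<times> {0<..})" using \<F> by blast
  then have "\<exists>C\<subseteq>I \<times> {0<..}. finite C \<and> \<F> - {W} = F ` C"
    by (rule finite_subset_image[OF finite_Diff[OF \<F>(1)]])
  then obtain C where C: "C \<subseteq> I \<times> {0<..}" "finite C" "\<F> - {W} = F ` C"
    by (elim exE conjE)
  define \<sigma> where "\<sigma> = Min (insert 1 (snd ` C))"
  have "\<sigma> \<in> insert 1 (snd ` C)" unfolding \<sigma>_def by (rule Min_in) (use C in auto)
  then have pos: "0 < \<sigma>" using C by auto
  have bound: "\<Psi> z < \<epsilon>" if z: "z \<in> topspace T" and lt: "\<And>i. i \<in> fst ` C \<Longrightarrow> N i z < \<sigma>" for z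
  proof (rule ccontr)
    assume "\<not> \<Psi> z < \<epsilon>"
    then have "z \<notin> W" by (simp add: W_def)
    obtain A where A: "A \<in> \<F>" "z \<in> A" using \<F>(3) z by blast
    then have "A \<in> F ` C" using \<open>z \<notin> W\<close> unfolding C(3)[symmetric] by blast
    then obtain p where p: "p \<in> C" "A = F p" by (rule imageE)
    obtain i s where is_pair: "p = (i, s)" by (cases p)
    then have mem: "(i, s) \<in> C" "N i z > s" using p A by (auto simp: F_def)
    have "s \<in> insert 1 (snd ` C)" using mem(1) by force
    then have "\<sigma> \<le> s" unfolding \<sigma>_def using C(2) by (intro Min_le) auto
    moreover have "N i z < \<sigma>" using mem by (intro lt) force
    ultimately show False using mem by linarith
  qed
  show ?thesis
  proof (rule exI[of _ "fst ` C"], rule exI[of _ \<sigma>], intro conjI ballI impI)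
    show "finite (fst ` C)" "fst ` C \<subseteq> I" "0 < \<sigma>" using C pos by auto
    fix z assume z: "z \<in> topspace T" and lt: "\<forall>i\<in>fst ` C. N i z < \<sigma>"
    show "\<Psi> z < \<epsilon>" by (rule bound[OF z bspec[OF lt]])
  qed
qed

lemma compact_space_uniformly_small:
  fixes N \<Psi> :: "'a \<Rightarrow> real"
  assumes "compact_space T" "continuous_map T euclideanreal N" "continuous_map T euclideanreal \<Psi>"
    and "\<And>z. z \<in> topspace T \<Longrightarrow> N z \<le> 0 \<Longrightarrow> \<Psi> z < \<epsilon>"
  shows "\<exists>\<sigma>>0. \<forall>z\<in>topspace T. N z < \<sigma> \<longrightarrow> \<Psi> z < \<epsilon>"
proof -
  obtain J \<sigma> where "J \<subseteq> {()}" "0 < \<sigma>"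
    "\<forall>z\<in>topspace T. (\<forall>i\<in>J. N z < \<sigma>) \<longrightarrow> \<Psi> z < \<epsilon>"
    using compact_space_uniform_bound[of T "{()}" "\<lambda>_. N" \<Psi> \<epsilon>] assms by auto
  then show ?thesis by blast
qed

lemma compact_metric_uniformly_continuous:
  assumes comp: "compact_space (mtopology_of X)"
    and f: "continuous_map (mtopology_of X) (mtopology_of X) f" and "0 < \<epsilon>"
  shows "\<exists>\<delta>>0. \<forall>x\<in>mspace X. \<forall>y\<in>mspace X. mdist X x y < \<delta> \<longrightarrow> mdist X (f x) (f y) < \<epsilon>"
proof -
  let ?M = "mtopology_of X"
  have "\<exists>\<delta>>0. \<forall>z\<in>topspace (prod_topology ?M ?M). mdist X (fst z) (snd z) < \<delta> \<longrightarrow>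
      mdist X (f (fst z)) (f (snd z)) < \<epsilon>"
  proof (rule compact_space_uniformly_small)
    show "compact_space (prod_topology ?M ?M)" using comp by (simp add: compact_space_prod_topology)
    show "continuous_map (prod_topology ?M ?M) euclideanreal (\<lambda>z. mdist X (fst z) (snd z))"
      by (intro continuous_map_mdist continuous_map_fst continuous_map_snd)
    show "continuous_map (prod_topology ?M ?M) euclideanreal (\<lambda>z. mdist X (f (fst z)) (f (snd z)))"
      using continuous_map_compose[OF continuous_map_fst f, of ?M] continuous_map_compose[OF continuous_map_snd f, of ?M]
      by (intro continuous_map_mdist) (simp_all add: o_def)
    fix z assume z: "z \<in> topspace (prod_topology ?M ?M)" "mdist X (fst z) (snd z) \<le> 0"
    then have "mdist X (fst z) (snd z) = 0" by (simp add: order_antisym)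
    then have "fst z = snd z" using z(1) by auto
    moreover have "f (snd z) \<in> mspace X" using z(1) continuous_map_funspace[OF f] by auto
    ultimately show "mdist X (f (fst z)) (f (snd z)) < \<epsilon>" using \<open>0 < \<epsilon>\<close> by (simp add: mdist_self)
  qed
  then obtain \<delta> where "0 < \<delta>" and *: "\<And>z. z \<in> topspace (prod_topology ?M ?M) \<Longrightarrow>
      mdist X (fst z) (snd z) < \<delta> \<Longrightarrow> mdist X (f (fst z)) (f (snd z)) < \<epsilon>"
    by blast
  then show ?thesis
    by (intro exI[of _ \<delta>] conjI ballI impI) (use *[of "(_, _)"] in simp_all)
qed

lemma quotient_map_factor:
  assumes q: "quotient_map X Y q" and h: "continuous_map X Z h"
    and eq: "\<And>x y. x \<in> topspace X \<Longrightarrow> y \<in> topspace X \<Longrightarrow> q x = q y \<Longrightarrow> h x = h y"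
  shows "\<exists>g. continuous_map Y Z g \<and> (\<forall>x\<in>topspace X. g (q x) = h x)"
proof (rule quotient_map_lift_exists[OF q h])
  show "h x = h y" if "x \<in> topspace X" "y \<in> topspace X" "q x = q y" for x y
    using that by (rule eq)
  fix g assume "continuous_map Y Z g" "\<And>x. x \<in> topspace X \<Longrightarrow> g (q x) = h x"
  then show ?thesis by (intro exI[of _ g]) simp
qed

lemma compact_space_quotient_image:
  "quotient_map X Y q \<Longrightarrow> compact_space X \<Longrightarrow> compact_space Y"
  using image_compactin[of X "topspace X" Y q]
  by (simp add: compact_space_def quotient_imp_continuous_map quotient_imp_surjective_map)

text \<open>
  The family embeds the compact space into a countable power of the line.
\<close>

lemma metrizable_of_separating_family:
  fixes F :: "'a \<Rightarrow> 'k::countable \<Rightarrow> real"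
  assumes comp: "compact_space Z" and cont: "\<And>k. continuous_map Z euclideanreal (\<lambda>z. F z k)"
    and inj: "inj_on F (topspace Z)"
  shows "metrizable_space Z"
proof -
  have "continuous_map Z (powertop_real UNIV) F"
    using cont by (simp add: continuous_map_componentwise_UNIV)
  moreover have "Hausdorff_space (powertop_real (UNIV :: 'k set))"
    by (simp add: Hausdorff_space_product_topology)
  ultimately have "embedding_map Z (powertop_real UNIV) F"
    using comp inj by (intro continuous_imp_embedding_map)
  then have "Z homeomorphic_space subtopology (powertop_real UNIV) (F ` topspace Z)"
    by (rule embedding_map_imp_homeomorphic_space)
  moreover have "metrizable_space (powertop_real (UNIV :: 'k set))"
    by (simp add: metrizable_space_product_topology metrizable_space_euclidean)
  ultimately show ?thesis
    using homeomorphic_metrizable_space metrizable_space_subtopology by blast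
qed

section \<open>Maps whose returning chains are confined\<close>

text \<open>
  The condition says more than that \<open>CR X g\<close> is covered by the small disjoint sets: it speaks of
  \<open>\<rho>\<close>-chains for one fixed \<open>\<rho>\<close>.  This makes it open in \<open>g\<close>, because a \<open>\<rho>/2\<close>-chain for a map within
  \<open>\<rho>/2\<close> of \<open>g\<close> is a \<open>\<rho>\<close>-chain for \<open>g\<close>.
\<close>

definition robust_chain_cover :: "'a metric \<Rightarrow> real \<Rightarrow> ('a \<Rightarrow> 'a) \<Rightarrow> bool" where
  "robust_chain_cover X \<epsilon> g \<longleftrightarrow>
     (\<exists>\<U> \<rho>. \<rho> > 0 \<and> (\<forall>U\<in>\<U>. openin (mtopology_of X) U) \<and> pairwise disjnt \<U> \<and>
        (\<forall>U\<in>\<U>. \<forall>x\<in>U. \<forall>y\<in>U. mdist X x y < \<epsilon>) \<and>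
        (\<forall>x n c. eps_chain X g \<rho> x x n c \<longrightarrow> x \<in> \<Union>\<U>))"

lemma robust_chain_coverE:
  assumes "robust_chain_cover X \<epsilon> g"
  obtains \<U> \<rho> where "\<rho> > 0" "\<forall>U\<in>\<U>. openin (mtopology_of X) U" "pairwise disjnt \<U>"
    "\<forall>U\<in>\<U>. \<forall>x\<in>U. \<forall>y\<in>U. mdist X x y < \<epsilon>"
    "\<forall>x n c. eps_chain X g \<rho> x x n c \<longrightarrow> x \<in> \<Union>\<U>"
  using assms unfolding robust_chain_cover_def by (elim exE conjE) (rule that)

lemma robust_chain_coverI:
  assumes "\<rho> > 0" "\<forall>U\<in>\<U>. openin (mtopology_of X) U" "pairwise disjnt \<U>"
    "\<forall>U\<in>\<U>. \<forall>x\<in>U. \<forall>y\<in>U. mdist X x y < \<epsilon>"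
    "\<forall>x n c. eps_chain X g \<rho> x x n c \<longrightarrow> x \<in> \<Union>\<U>"
  shows "robust_chain_cover X \<epsilon> g"
  unfolding robust_chain_cover_def
  by (rule exI[of _ \<U>], rule exI[of _ \<rho>]) (intro conjI assms)

lemma robust_chain_cover_mono:
  assumes "robust_chain_cover X \<delta> g" "\<delta> \<le> \<epsilon>"
  shows "robust_chain_cover X \<epsilon> g"
  using assms(1)
proof (rule robust_chain_coverE)
  fix \<U> \<rho>
  assume U: "\<rho> > 0" "\<forall>U\<in>\<U>. openin (mtopology_of X) U" "pairwise disjnt \<U>"
    and d: "\<forall>U\<in>\<U>. \<forall>x\<in>U. \<forall>y\<in>U. mdist X x y < \<delta>"
    and ch: "\<forall>x n c. eps_chain X g \<rho> x x n c \<longrightarrow> x \<in> \<Union>\<U>"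
  have "\<forall>U\<in>\<U>. \<forall>x\<in>U. \<forall>y\<in>U. mdist X x y < \<epsilon>"
    using d assms(2) by (meson less_le_trans)
  from U this ch show ?thesis by (rule robust_chain_coverI)
qed

lemma eps_chain_perturb:
  assumes "eps_chain X h \<rho> x y n c"
    and "h \<in> mspace X \<rightarrow> mspace X" "g \<in> mspace X \<rightarrow> mspace X"
    and "\<And>z. z \<in> mspace X \<Longrightarrow> mdist X (g z) (h z) \<le> \<delta>"
  shows "eps_chain X g (\<delta> + \<rho>) x y n c"
proof -
  have "mdist X (g (c (i - 1))) (c i) < \<delta> + \<rho>" if i: "i \<in> {1..n}" for i
  proof -
    have m: "c (i - 1) \<in> mspace X" "c i \<in> mspace X" "mdist X (h (c (i - 1))) (c i) < \<rho>"
      using assms(1) i unfolding eps_chain_def by auto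
    then have "mdist X (g (c (i - 1))) (c i)
        \<le> mdist X (g (c (i - 1))) (h (c (i - 1))) + mdist X (h (c (i - 1))) (c i)"
      using assms(2,3) by (intro mdist_triangle) auto
    then show ?thesis using m assms(4)[of "c (i - 1)"] by linarith
  qed
  then show ?thesis using assms(1) unfolding eps_chain_def by blast
qed

text \<open>
  The chain recurrent set lies in the union of each such cover, so every member of the cover cuts it in
  a relatively clopen piece: the remaining members are open as well.
\<close>

lemma CR_dim_le_0:
  assumes "\<And>\<epsilon>. \<epsilon> > 0 \<Longrightarrow> robust_chain_cover X \<epsilon> g"
  shows "subtopology (mtopology_of X) (CR X g) dim_le 0"
proof -
  let ?C = "subtopology (mtopology_of X) (CR X g)"
  have sub: "CR X g \<subseteq> mspace X" by (auto simp: CR_def)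
  have "\<exists>U. openin ?C U \<and> closedin ?C U \<and> x \<in> U \<and> U \<subseteq> W"
    if W: "openin ?C W" and x: "x \<in> W" for W x
  proof -
    obtain V where V: "openin (mtopology_of X) V" "W = V \<inter> CR X g"
      using W by (auto simp: openin_subtopology)
    interpret Metric_space "mspace X" "mdist X" by simp
    have xV: "x \<in> V" "x \<in> CR X g" using x V by auto
    then obtain e where e: "e > 0" "mball x e \<subseteq> V"
      using V(1) unfolding mtopology_of_def openin_mtopology by blast
    obtain \<U> \<rho> where \<U>: "\<rho> > 0" "\<forall>U\<in>\<U>. openin (mtopology_of X) U" "pairwise disjnt \<U>"
      "\<forall>U\<in>\<U>. \<forall>x\<in>U. \<forall>y\<in>U. mdist X x y < e" "\<forall>x n c. eps_chain X g \<rho> x x n c \<longrightarrow> x \<in> \<Union>\<U>"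
      by (rule robust_chain_coverE[OF assms[OF e(1)]])
    have cov: "CR X g \<subseteq> \<Union>\<U>" using \<U>(1,5) unfolding CR_def by fast
    then obtain U where U: "U \<in> \<U>" "x \<in> U" using xV(2) by blast
    let ?U = "U \<inter> CR X g"
    have "openin ?C ?U" using \<U>(2) U by (auto simp: openin_subtopology)
    moreover have "closedin ?C ?U"
    proof -
      have "openin ?C (\<Union>(\<U> - {U}) \<inter> CR X g)"
        using \<U>(2) by (intro openin_subtopology_Int openin_Union) blast
      moreover have "CR X g - ?U = \<Union>(\<U> - {U}) \<inter> CR X g"
      proof -
        have "U' \<inter> U = {}" if "U' \<in> \<U>" "U' \<noteq> U" for U'
          using \<U>(3) U(1) that by (auto simp: pairwise_def disjnt_def)
        then show ?thesis using cov by blast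
      qed
      ultimately show ?thesis using sub
        by (simp add: closedin_def topspace_subtopology Int_absorb1)
    qed
    moreover have "?U \<subseteq> W"
    proof
      fix y assume y: "y \<in> ?U"
      then have "y \<in> mball x e" using U \<U>(4) sub xV by auto
      then show "y \<in> W" using e V y by blast
    qed
    ultimately show ?thesis using U xV by blast
  qed
  then show ?thesis
    unfolding dimension_le_0_neighbourhood_base_of_clopen
    by (subst open_neighbourhood_base_of) blast+
qed

text \<open>
  For each \<open>n\<close> the maps with a robust cover of mesh \<open>1/(n+1)\<close> form an open set, which is dense by
  assumption.  The space of continuous self-maps is complete, so Baire's theorem applies to these sets.
\<close>

lemma zero_CR_of_dense_robust:
  assumes comp: "compact_space (mtopology_of X)"
    and dense: "\<And>f \<epsilon>. continuous_map (mtopology_of X) (mtopology_of X) f \<Longrightarrow> \<epsilon> > 0 \<Longrightarrow>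
        \<exists>g. continuous_map (mtopology_of X) (mtopology_of X) g \<and>
          (\<forall>x\<in>mspace X. mdist X (f x) (g x) < \<epsilon>) \<and> robust_chain_cover X \<epsilon> g"
  shows "X \<in> zero_CR"
proof -
  let ?M = "mtopology_of X" and ?F = "cfunspace (mtopology_of X) X"
  note mspace_cfunspace [simp del]
  interpret X: Metric_space "mspace X" "mdist X" by simp
  interpret F: Metric_space "mspace ?F" "mdist ?F" by (rule Metric_space_mspace_mdist)
  have Ft: "mtopology_of ?F = F.mtopology" by (simp add: mtopology_of_def)
  have memF: "f \<in> mspace ?F \<longleftrightarrow> f \<in> mspace X \<rightarrow> mspace X \<and> f \<in> extensional (mspace X) \<and> continuous_map ?M ?M f" for f
    using compactin_mspace_cfunspace[of ?M X] comp by (auto simp: compact_space_def)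
  define G where "G = (\<lambda>n. {f \<in> mspace ?F. robust_chain_cover X (1 / real (Suc n)) f})"
  \<comment> \<open>open: half of the tolerance \<open>\<rho>\<close> of \<open>g\<close> is left to the maps in the ball of radius \<open>\<rho>/2\<close>\<close>
  have op: "openin F.mtopology (G n)" for n
    unfolding F.openin_mtopology
  proof (intro conjI allI impI)
    show "G n \<subseteq> mspace ?F" by (auto simp: G_def)
    fix g assume g: "g \<in> G n"
    then have "robust_chain_cover X (1 / real (Suc n)) g" by (simp add: G_def)
    then obtain \<U> \<rho> where \<U>: "\<rho> > 0" "\<forall>U\<in>\<U>. openin (mtopology_of X) U" "pairwise disjnt \<U>"
      "\<forall>U\<in>\<U>. \<forall>x\<in>U. \<forall>y\<in>U. mdist X x y < 1 / real (Suc n)"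
      "\<forall>x n c. eps_chain X g \<rho> x x n c \<longrightarrow> x \<in> \<Union>\<U>"
      by (rule robust_chain_coverE)
    have "F.mball g (\<rho> / 2) \<subseteq> G n"
    proof
      fix h assume h: "h \<in> F.mball g (\<rho> / 2)"
      then have m: "h \<in> mspace ?F" "g \<in> mspace ?F" and d: "mdist ?F g h \<le> \<rho> / 2"
        by (auto simp: F.mball_def)
      have "mdist X (g z) (h z) \<le> \<rho> / 2" if "z \<in> mspace X" for z
        using mdist_cfunspace_imp_mdist_le[OF m(2,1) d] that by simp
      then have "eps_chain X g \<rho> x x k c" if "eps_chain X h (\<rho> / 2) x x k c" for x k c
        using eps_chain_perturb[OF that, of g "\<rho> / 2"] m unfolding memF by simp
      then have ch: "\<forall>x k c. eps_chain X h (\<rho> / 2) x x k c \<longrightarrow> x \<in> \<Union>\<U>"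
        using \<U>(5) by metis
      have "0 < \<rho> / 2" using \<U>(1) by simp
      from this \<U>(2-4) ch have "robust_chain_cover X (1 / real (Suc n)) h"
        by (rule robust_chain_coverI)
      then show "h \<in> G n" using m by (simp add: G_def)
    qed
    then show "\<exists>r>0. F.mball g r \<subseteq> G n" using \<U>(1) by (intro exI[of _ "\<rho> / 2"]) auto
  qed
  have dn: "F.mtopology closure_of (G n) = mspace ?F" for n
  proof
    show "F.mtopology closure_of (G n) \<subseteq> mspace ?F"
      using closure_of_subset_topspace[of F.mtopology] by simp
    show "mspace ?F \<subseteq> F.mtopology closure_of (G n)"
      unfolding F.metric_closure_of
    proof (intro subsetI CollectI conjI allI impI)
      fix f assume f: "f \<in> mspace ?F"
      then show "f \<in> mspace ?F" .
      fix r :: real assume r: "r > 0"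
      define \<epsilon> where "\<epsilon> = min (r / 2) (1 / real (Suc n))"
      have \<epsilon>: "\<epsilon> > 0" "\<epsilon> < r" "\<epsilon> \<le> 1 / real (Suc n)" using r by (auto simp: \<epsilon>_def min_def)
      obtain g where g: "continuous_map ?M ?M g" "\<forall>x\<in>mspace X. mdist X (f x) (g x) < \<epsilon>" "robust_chain_cover X \<epsilon> g"
        using dense[of f \<epsilon>] f \<epsilon> unfolding memF by blast
      \<comment> \<open>members of the function space are extensional; restricting to the space changes no chain\<close>
      let ?g = "restrict g (mspace X)"
      have gM: "g \<in> mspace X \<rightarrow> mspace X" using continuous_map_funspace[OF g(1)] by simp
      have cg: "continuous_map ?M ?M ?g"
        by (rule continuous_map_eq[OF g(1)]) auto
      then have gF: "?g \<in> mspace ?F" using gM unfolding memF by auto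
      have ch: "eps_chain X ?g \<rho> x y k c \<longleftrightarrow> eps_chain X g \<rho> x y k c" for \<rho> x y k c
        unfolding eps_chain_def by (intro conj_cong refl ball_cong) auto
      have "robust_chain_cover X \<epsilon> ?g"
        using g(3) by (simp add: robust_chain_cover_def ch)
      then have "robust_chain_cover X (1 / real (Suc n)) ?g"
        using \<epsilon>(3) robust_chain_cover_mono by blast
      then have "?g \<in> G n" using gF by (simp add: G_def)
      moreover have "mdist ?F f ?g \<le> \<epsilon>"
        using g(2) \<epsilon> by (intro mdist_cfunspace_le) (auto intro: less_imp_le)
      ultimately show "\<exists>y\<in>G n. y \<in> F.mball f r"
        using \<epsilon> f gF by (intro bexI[of _ ?g]) auto
    qed
  qed
  have "mcomplete_of ?F"
    using X.mcomplete_cfunspace[of ?M] X.compact_space_imp_mcomplete comp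
    by (simp add: mtopology_of_def X.Self_def)
  then have "F.mcomplete" by (simp add: mcomplete_of_def)
  then have cl: "F.mtopology closure_of \<Inter>(range G) = mspace ?F"
    by (rule F.metric_Baire_category) (use op dn in auto)
  have gd: "gdelta_in F.mtopology (\<Inter>(range G))"
    by (rule gdelta_in_Inter) (use op in \<open>auto intro: open_imp_gdelta_in\<close>)
  have sub: "\<Inter>(range G) \<subseteq> {f \<in> mspace ?F. subtopology ?M (CR X f) dim_le 0}"
  proof
    fix f assume f: "f \<in> \<Inter>(range G)"
    have "robust_chain_cover X \<epsilon> f" if "\<epsilon> > 0" for \<epsilon>
    proof -
      obtain n where n: "1 / real (Suc n) < \<epsilon>" using \<open>\<epsilon> > 0\<close> nat_approx_posE by metis
      have "robust_chain_cover X (1 / real (Suc n)) f" using f by (auto simp: G_def)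
      then show ?thesis using n robust_chain_cover_mono less_imp_le by blast
    qed
    then show "f \<in> {f \<in> mspace ?F. subtopology ?M (CR X f) dim_le 0}"
      using CR_dim_le_0 f by (auto simp: G_def)
  qed
  have "residual_in F.mtopology {f \<in> mspace ?F. subtopology ?M (CR X f) dim_le 0}"
    unfolding residual_in_def
  proof (intro conjI exI[of _ "\<Inter>(range G)"])
    show "{f \<in> mspace ?F. subtopology ?M (CR X f) dim_le 0} \<subseteq> topspace F.mtopology" by auto
    show "F.mtopology closure_of \<Inter>(range G) = topspace F.mtopology" using cl by simp
  qed (rule sub gd)+
  then show ?thesis
    using comp by (simp add: zero_CR_def generic_map_def Ft)
qed

text \<open>
  Let \<open>L x\<close> be the set of weights that are at least \<open>\<eta>\<close> at \<open>x\<close> and \<open>P x\<close> the set of those that are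
  positive.  An error below \<open>\<rho>\<close> changes each weight by less than \<open>\<eta>/2\<close>, so one step of a \<open>\<rho>\<close>-chain from
  \<open>c\<close> to \<open>c'\<close> gives \<open>L c' \<subseteq> P (g c)\<close>, while \<open>P (g c)\<close> has at most as many elements as \<open>L c\<close>.  Along a
  chain from \<open>x\<close> to \<open>x\<close> all these cardinalities agree, and the last step yields
  \<open>L x = P (g c)\<close>: a weight outside \<open>L x\<close> is nonpositive at \<open>g c\<close>, hence below \<open>\<eta>/2\<close> at \<open>x\<close>.
  So \<open>x\<close> lies in the open set of points where the weights in \<open>L x\<close> exceed \<open>\<eta>/2\<close> and all others are
  below \<open>\<eta>/2\<close>.  These sets are disjoint for different labels, and small since labels are nonempty.
\<close>

lemma robust_chain_cover_of_weights:
  fixes w :: "'b \<Rightarrow> 'a \<Rightarrow> real"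
  assumes comp: "compact_space (mtopology_of X)" and B: "finite B"
    and w: "\<And>b. b \<in> B \<Longrightarrow> continuous_map (mtopology_of X) euclideanreal (w b)"
    and g: "g \<in> mspace X \<rightarrow> mspace X" and \<eta>: "\<eta> > 0"
    and some: "\<And>x. x \<in> mspace X \<Longrightarrow> \<exists>b\<in>B. \<eta> \<le> w b x"
    and drop: "\<And>x. x \<in> mspace X \<Longrightarrow> card {b \<in> B. 0 < w b (g x)} \<le> card {b \<in> B. \<eta> \<le> w b x}"
    and small: "\<And>b x y. b \<in> B \<Longrightarrow> x \<in> mspace X \<Longrightarrow> y \<in> mspace X \<Longrightarrow> 0 < w b x \<Longrightarrow> 0 < w b y \<Longrightarrow>
       mdist X x y < \<epsilon>"
  shows "robust_chain_cover X \<epsilon> g"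
proof -
  let ?M = "mtopology_of X"
  have "compact_space (prod_topology ?M ?M)"
    using comp by (simp add: compact_space_prod_topology)
  moreover have "continuous_map (prod_topology ?M ?M) euclideanreal (\<lambda>z. mdist X (fst z) (snd z))"
    by (intro continuous_map_mdist continuous_map_fst continuous_map_snd)
  moreover have "continuous_map (prod_topology ?M ?M) euclideanreal (\<lambda>z. \<Sum>b\<in>B. \<bar>w b (fst z) - w b (snd z)\<bar>)"
  proof (intro continuous_map_sum B continuous_map_real_abs continuous_map_diff)
    fix b assume "b \<in> B"
    show "continuous_map (prod_topology ?M ?M) euclideanreal (\<lambda>z. w b (fst z))"
      using continuous_map_compose[OF continuous_map_fst w[OF \<open>b \<in> B\<close>]] by (simp add: o_def)
    show "continuous_map (prod_topology ?M ?M) euclideanreal (\<lambda>z. w b (snd z))"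
      using continuous_map_compose[OF continuous_map_snd w[OF \<open>b \<in> B\<close>]] by (simp add: o_def)
  qed
  moreover have "(\<Sum>b\<in>B. \<bar>w b (fst z) - w b (snd z)\<bar>) < \<eta> / 2"
    if "z \<in> topspace (prod_topology ?M ?M)" "mdist X (fst z) (snd z) \<le> 0" for z
  proof -
    have "mdist X (fst z) (snd z) = 0" using that(2) by (simp add: order_antisym)
    then have "fst z = snd z" using that(1) by auto
    then show ?thesis using \<eta> by simp
  qed
  ultimately have "\<exists>\<rho>>0. \<forall>z\<in>topspace (prod_topology ?M ?M). mdist X (fst z) (snd z) < \<rho> \<longrightarrow>
       (\<Sum>b\<in>B. \<bar>w b (fst z) - w b (snd z)\<bar>) < \<eta> / 2"
    by (rule compact_space_uniformly_small)
  then obtain \<rho> where \<rho>: "0 < \<rho>"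
    "\<And>z. z \<in> topspace (prod_topology ?M ?M) \<Longrightarrow> mdist X (fst z) (snd z) < \<rho> \<Longrightarrow>
       (\<Sum>b\<in>B. \<bar>w b (fst z) - w b (snd z)\<bar>) < \<eta> / 2"
    by blast
  have near: "\<bar>w b y - w b z\<bar> < \<eta> / 2" if "y \<in> mspace X" "z \<in> mspace X" "mdist X y z < \<rho>" "b \<in> B" for b y z
  proof -
    have "\<bar>w b y - w b z\<bar> \<le> (\<Sum>b\<in>B. \<bar>w b y - w b z\<bar>)"
      using that B by (intro member_le_sum) auto
    then show ?thesis using \<rho>(2)[of "(y, z)"] that by simp
  qed
  define L where "L = (\<lambda>x. {b \<in> B. \<eta> \<le> w b x})"
  define P where "P = (\<lambda>x. {b \<in> B. 0 < w b x})"
  define O' where "O' = (\<lambda>A. (\<Inter>b\<in>B. {x \<in> topspace ?M. w b x \<in> (if b \<in> A then {\<eta>/2<..} else {..<\<eta>/2})}) \<inter> topspace ?M)"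
  let ?U = "O' ` {A. A \<subseteq> B \<and> A \<noteq> {}}"
  have "openin ?M (O' A)" for A
    unfolding O'_def
    by (intro openin_INT B openin_continuous_map_preimage[OF w]) auto
  then have op: "\<forall>U\<in>?U. openin ?M U" by blast
  have disj: "pairwise disjnt ?U"
  proof -
    have "A = A'" if "A \<subseteq> B" "A' \<subseteq> B" "x \<in> O' A" "x \<in> O' A'" for A A' x
    proof -
      have "b \<in> A \<longleftrightarrow> b \<in> A'" if b: "b \<in> B" for b
        using \<open>x \<in> O' A\<close> \<open>x \<in> O' A'\<close> b unfolding O'_def
        by (force split: if_splits)
      then show ?thesis using that by blast
    qed
    then show ?thesis unfolding pairwise_def disjnt_def by blast
  qed
  have "mdist X x y < \<epsilon>" if A: "A \<subseteq> B" "A \<noteq> {}" "x \<in> O' A" "y \<in> O' A" for A x y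
  proof -
    obtain b where b: "b \<in> A" "b \<in> B" using A by blast
    have "w b x > \<eta>/2" "w b y > \<eta>/2" "x \<in> mspace X" "y \<in> mspace X"
      using A b unfolding O'_def by auto
    then show ?thesis using small[OF b(2)] \<eta> by simp
  qed
  then have sm: "\<forall>U\<in>?U. \<forall>x\<in>U. \<forall>y\<in>U. mdist X x y < \<epsilon>" by blast
  have "x \<in> \<Union>?U" if ch: "eps_chain X g \<rho> x x n c" for x n c
  proof -
    have n: "1 \<le> n" "c 0 = x" "c n = x" and cM: "\<And>i. i \<le> n \<Longrightarrow> c i \<in> mspace X"
      using ch unfolding eps_chain_def by auto
    have cd: "mdist X (g (c i)) (c (Suc i)) < \<rho>" if "i < n" for i
    proof -
      have "\<forall>i\<in>{1..n}. mdist X (g (c (i - 1))) (c i) < \<rho>" using ch by (simp add: eps_chain_def)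
      from bspec[OF this, of "Suc i"] show ?thesis using that by simp
    qed
    have gM: "g (c i) \<in> mspace X" if "i \<le> n" for i using cM[OF that] g by auto
    have LP: "L (c (Suc i)) \<subseteq> P (g (c i))" if "i < n" for i
    proof
      fix b assume "b \<in> L (c (Suc i))"
      then have "b \<in> B" "\<eta> \<le> w b (c (Suc i))" by (auto simp: L_def)
      then show "b \<in> P (g (c i))"
        using near[OF gM cM cd, of i b] that \<eta> unfolding P_def by (simp add: abs_if split: if_splits)
    qed
    have PL: "card (P (g (c i))) \<le> card (L (c i))" if "i \<le> n" for i
      using drop[OF cM[OF that]] by (simp add: P_def L_def)
    have finP: "finite (P y)" for y using B by (simp add: P_def)
    have "i \<le> n \<Longrightarrow> card (L (c i)) \<le> card (L x)" for i
    proof (induction i)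
      case (Suc i)
      then have "card (L (c (Suc i))) \<le> card (P (g (c i)))"
        by (intro card_mono finP LP) auto
      then show ?case using PL[of i] Suc by simp
    qed (use n in simp)
    from this[of "n - 1"] have "card (P (g (c (n - 1)))) \<le> card (L x)"
      using PL[of "n - 1"] by simp
    moreover have "L x \<subseteq> P (g (c (n - 1)))" using LP[of "n - 1"] n by simp
    ultimately have eq: "L x = P (g (c (n - 1)))" using finP by (intro card_seteq)
    have xM: "x \<in> mspace X" using cM[of 0] n by simp
    have "w b x < \<eta> / 2" if b: "b \<in> B" "b \<notin> L x" for b
    proof -
      have "w b (g (c (n - 1))) \<le> 0" using b eq by (auto simp: P_def)
      moreover have "\<bar>w b (g (c (n - 1))) - w b x\<bar> < \<eta> / 2"
        using cd[of "n - 1"] n gM[of "n - 1"] xM b by (intro near) auto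
      ultimately show ?thesis by linarith
    qed
    then have "x \<in> O' (L x)" using \<eta> xM unfolding O'_def by (auto simp: L_def)
    moreover have "L x \<noteq> {}" using some[OF xM] by (auto simp: L_def)
    moreover have "L x \<subseteq> B" by (auto simp: L_def)
    ultimately show ?thesis by blast
  qed
  then have "\<forall>x n c. eps_chain X g \<rho> x x n c \<longrightarrow> x \<in> \<Union>?U" by (intro allI impI)
  with op disj sm show ?thesis by (rule robust_chain_coverI[OF \<rho>(1)])
qed

section \<open>Kuhn triangulations\<close>

definition kuhn_vertex :: "('v \<Rightarrow> real) \<Rightarrow> real \<Rightarrow> 'v \<Rightarrow> int" where
  "kuhn_vertex x \<theta> = (\<lambda>v. \<lceil>x v - \<theta>\<rceil>)"

text \<open>
  The vertices of the simplex of the Kuhn triangulation with vertex set \<open>\<int>\<^sup>V\<close> that has \<open>x\<close> in its relative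
  interior.  As \<open>\<theta>\<close> grows from 0 to 1, \<open>kuhn_vertex x \<theta>\<close> runs through them from the largest to the smallest;
  integer coordinates of \<open>x\<close> are left unchanged throughout.
\<close>

definition kuhn_carrier :: "('v \<Rightarrow> real) \<Rightarrow> ('v \<Rightarrow> int) set" where
  "kuhn_carrier x = kuhn_vertex x ` {0..<1}"

text \<open>
  The thresholds at which \<open>kuhn_vertex x\<close> jumps, together with the initial threshold 0.
\<close>

definition breaks :: "('v \<Rightarrow> real) \<Rightarrow> real set" where
  "breaks x = insert 0 (range (\<lambda>v. frac (x v)))"

lemma ceiling_diff_threshold:
  fixes x \<theta> :: real
  assumes "0 \<le> \<theta>" "\<theta> < 1"
  shows "\<lceil>x - \<theta>\<rceil> = \<lfloor>x\<rfloor> + (if \<theta> < frac x then 1 else 0)"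
  using assms unfolding frac_def by (auto simp: ceiling_eq_iff) linarith+

text \<open>
  The vertex is constant between consecutive breaks, and at each break some coordinate drops.  Hence the
  dimension of the simplex around \<open>x\<close> is the number of nonzero fractional parts.
\<close>

lemma bij_betw_breaks_kuhn_carrier:
  assumes "finite (range x)"
  shows "bij_betw (kuhn_vertex x) (breaks x) (kuhn_carrier x)"
proof -
  have fin: "finite (breaks x)"
    using finite_imageI[OF assms, of frac] by (simp add: breaks_def image_image)
  have sub: "breaks x \<subseteq> {0..<1}"
    by (auto simp: breaks_def frac_lt_1)
  have neq: "kuhn_vertex x \<theta> \<noteq> kuhn_vertex x \<tau>" if "\<theta> \<in> breaks x" "\<tau> \<in> breaks x" "\<theta> < \<tau>" for \<theta> \<tau>
  proof -
    have "\<tau> \<noteq> 0" using that sub by force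
    with \<open>\<tau> \<in> breaks x\<close> have "\<exists>v. \<tau> = frac (x v)" by (auto simp: breaks_def)
    then obtain v where v: "\<tau> = frac (x v)" ..
    have "\<theta> \<in> {0..<1}" "\<tau> \<in> {0..<1}" using that sub by auto
    then have "kuhn_vertex x \<theta> v \<noteq> kuhn_vertex x \<tau> v"
      using that(3) by (simp add: kuhn_vertex_def ceiling_diff_threshold v)
    then show ?thesis by metis
  qed
  have inj: "inj_on (kuhn_vertex x) (breaks x)"
    by (rule linorder_inj_onI) (use neq in auto)
  have "kuhn_vertex x \<theta> \<in> kuhn_vertex x ` breaks x" if \<theta>: "\<theta> \<in> {0..<1}" for \<theta>
  proof -
    let ?L = "{\<tau> \<in> breaks x. \<tau> \<le> \<theta>}"
    define \<tau> where "\<tau> = Max ?L"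
    have L: "finite ?L" "0 \<in> ?L" using fin \<theta> by (auto simp: breaks_def)
    have "\<tau> \<in> ?L" unfolding \<tau>_def by (rule Max_in) (use L in blast)+
    then have \<tau>: "\<tau> \<in> breaks x" "\<tau> \<le> \<theta>" by auto
    have "(\<tau> < frac (x v)) = (\<theta> < frac (x v))" for v
    proof -
      have "frac (x v) \<le> \<tau>" if "frac (x v) \<le> \<theta>"
        unfolding \<tau>_def by (rule Max_ge) (use that L in \<open>auto simp: breaks_def\<close>)
      then show ?thesis using \<tau> by force
    qed
    then have "kuhn_vertex x \<theta> = kuhn_vertex x \<tau>"
      using \<theta> \<tau> sub by (force simp: kuhn_vertex_def ceiling_diff_threshold)
    then show ?thesis using \<tau> by blast
  qed
  then have "kuhn_vertex x ` breaks x = kuhn_carrier x"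
    unfolding kuhn_carrier_def using sub by blast
  then show ?thesis using inj by (simp add: bij_betw_def)
qed

lemma finite_breaks: "finite (range x) \<Longrightarrow> finite (breaks x)"
  using finite_imageI[of "range x" frac] by (simp add: breaks_def image_image)

text \<open>
  The triangulation of mesh \<open>1/M\<close> subdivides the one of mesh 1, so a skeleton of the coarse triangulation
  lies in the skeleton of the same dimension of the fine one.  In terms of breaks: the fractional part of
  \<open>M y\<close> is determined by that of \<open>y\<close>.
\<close>

lemma card_kuhn_carrier_multiple_le:
  fixes x :: "'v \<Rightarrow> real"
  assumes "finite (range x)"
  shows "card (kuhn_carrier (\<lambda>v. of_nat M * x v)) \<le> card (kuhn_carrier x)"
proof -
  have fr: "frac (of_nat M * y) = frac (of_nat M * frac y)" for y :: real
  proof -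
    have "of_nat M * y = of_nat M * frac y + of_int (int M * \<lfloor>y\<rfloor>)"
      by (simp add: frac_def algebra_simps)
    then show ?thesis by (metis Ints_of_int frac_add_int_right)
  qed
  have fM: "finite (range (\<lambda>v. of_nat M * x v))"
    using finite_imageI[OF assms, of "\<lambda>r. of_nat M * r"] by (simp add: image_image)
  have "breaks (\<lambda>v. of_nat M * x v) \<subseteq> (\<lambda>\<tau>. frac (of_nat M * \<tau>)) ` breaks x"
    unfolding breaks_def by (auto simp: image_iff fr[of "x _"])
  then have "card (breaks (\<lambda>v. of_nat M * x v)) \<le> card (breaks x)"
    using finite_breaks[OF assms] by (meson card_image_le card_mono finite_imageI le_trans)
  then show ?thesis
    using bij_betw_same_card[OF bij_betw_breaks_kuhn_carrier[OF fM]]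
      bij_betw_same_card[OF bij_betw_breaks_kuhn_carrier[OF assms]] by simp
qed

lemma finite_arg_max:
  fixes f :: "'b \<Rightarrow> real"
  assumes "finite S" "S \<noteq> {}"
  shows "\<exists>m\<in>S. \<forall>b\<in>S. f b \<le> f m"
proof -
  have "Max (f ` S) \<in> f ` S" using assms by simp
  then show ?thesis using assms by (metis (no_types, lifting) Max_ge finite_imageI image_iff)
qed

text \<open>
  A convex combination of vertices of one simplex lies in the face that they span.  For a threshold \<open>\<phi>\<close>
  the vertex of the combination is the one at the smallest \<open>\<theta> b\<close> for which the weights of all vertices up to
  \<open>\<theta> b\<close> sum to more than \<open>\<phi>\<close>: in a coordinate \<open>v\<close>, the excess of the combination over
  \<open>\<lfloor>y v\<rfloor>\<close> is the total weight of the vertices with threshold below \<open>frac (y v)\<close>.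
\<close>

lemma kuhn_carrier_convex_combination:
  fixes y :: "'v \<Rightarrow> real" and c :: "'b \<Rightarrow> real" and \<theta> :: "'b \<Rightarrow> real"
  assumes B: "finite B" and c0: "\<And>b. b \<in> B \<Longrightarrow> 0 \<le> c b" and c1: "sum c B = 1"
    and th: "\<And>b. b \<in> B \<Longrightarrow> \<theta> b \<in> {0..<1}"
  shows "kuhn_carrier (\<lambda>v. \<Sum>b\<in>B. c b * of_int \<lceil>y v - \<theta> b\<rceil>) \<subseteq> (\<lambda>b. kuhn_vertex y (\<theta> b)) ` B"
proof
  fix a assume "a \<in> kuhn_carrier (\<lambda>v. \<Sum>b\<in>B. c b * of_int \<lceil>y v - \<theta> b\<rceil>)"
  then obtain \<phi> where \<phi>: "0 \<le> \<phi>" "\<phi> < 1"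
    and a: "a = (\<lambda>v. \<lceil>(\<Sum>b\<in>B. c b * of_int \<lceil>y v - \<theta> b\<rceil>) - \<phi>\<rceil>)"
    by (auto simp: kuhn_carrier_def kuhn_vertex_def)
  define T where "T = (\<lambda>s. sum c {b \<in> B. \<theta> b \<le> s})"
  define G where "G = {b \<in> B. T (\<theta> b) > \<phi>}"
  have "B \<noteq> {}" using c1 by auto
  then obtain bm where bm: "bm \<in> B" "\<And>b. b \<in> B \<Longrightarrow> \<theta> b \<le> \<theta> bm"
    using finite_arg_max[OF B, of \<theta>] by blast
  have "T (\<theta> bm) = 1" using bm c1 unfolding T_def by (metis (mono_tags, lifting) Collect_cong Collect_mem_eq)
  then have "G \<noteq> {}" "finite G" using bm B \<phi> by (auto simp: G_def)
  then obtain b0 where b0: "b0 \<in> G" "\<And>b. b \<in> G \<Longrightarrow> \<theta> b0 \<le> \<theta> b"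
    using finite_arg_max[of G "\<lambda>b. - \<theta> b"] by force
  have b0B: "b0 \<in> B" "T (\<theta> b0) > \<phi>" using b0 by (auto simp: G_def)
  have "a v = \<lceil>y v - \<theta> b0\<rceil>" for v
  proof -
    let ?f = "frac (y v)"
    define s where "s = sum c {b \<in> B. \<theta> b < ?f}"
    have s1: "0 \<le> s" "s \<le> 1"
      using c0 c1 sum_mono2[OF B, of "{b \<in> B. \<theta> b < ?f}" c] by (auto simp: s_def intro!: sum_nonneg)
    have "(\<Sum>b\<in>B. c b * of_int \<lceil>y v - \<theta> b\<rceil>) =
          (\<Sum>b\<in>B. c b * of_int \<lfloor>y v\<rfloor> + (if \<theta> b < ?f then c b else 0))"
      by (rule sum.cong) (use th in \<open>auto simp: ceiling_diff_threshold algebra_simps\<close>)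
    also have "\<dots> = of_int \<lfloor>y v\<rfloor> + s"
      using B c1 by (simp add: sum.distrib s_def sum.inter_filter flip: sum_distrib_right)
    finally have av: "a v = \<lceil>of_int \<lfloor>y v\<rfloor> + s - \<phi>\<rceil>" by (simp add: a)
    have "s > \<phi>" if "\<theta> b0 < ?f"
    proof -
      have "T (\<theta> b0) \<le> s" unfolding T_def s_def
        by (rule sum_mono2) (use B that c0 in auto)
      then show ?thesis using b0B by simp
    qed
    moreover have "s \<le> \<phi>" if f: "\<not> \<theta> b0 < ?f"
    proof (cases "{b \<in> B. \<theta> b < ?f} = {}")
      case True
      then show ?thesis using \<phi> unfolding s_def by (metis sum.empty)
    next
      case False
      then obtain b1 where b1: "b1 \<in> B" "\<theta> b1 < ?f" "\<And>b. b \<in> B \<Longrightarrow> \<theta> b < ?f \<Longrightarrow> \<theta> b \<le> \<theta> b1"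
        using B finite_arg_max[of "{b \<in> B. \<theta> b < ?f}" \<theta>] by auto
      have "{b \<in> B. \<theta> b < ?f} = {b \<in> B. \<theta> b \<le> \<theta> b1}" using b1 by force
      then have "s = T (\<theta> b1)" by (simp add: s_def T_def)
      moreover have "b1 \<notin> G" using b0(2)[of b1] f b1 by force
      ultimately show ?thesis using b1 by (simp add: G_def)
    qed
    ultimately show ?thesis
      using s1 \<phi> th[OF b0B(1)] unfolding av
      by (auto simp add: ceiling_diff_threshold[of "\<theta> b0"] ceiling_eq_iff)
  qed
  then show "a \<in> (\<lambda>b. kuhn_vertex y (\<theta> b)) ` B"
    using b0B by (auto simp: kuhn_vertex_def)
qed

text \<open>
  A continuous function that is positive exactly on the open star of the vertex \<open>a\<close>.  With
  \<open>d v = x v - a v\<close>, the factors are positive if and only if the intervals \<open>[d v, d v + 1)\<close> and \<open>[0, 1)\<close>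
  meet pairwise.
\<close>

definition kuhn_hat :: "'v set \<Rightarrow> ('v \<Rightarrow> int) \<Rightarrow> ('v \<Rightarrow> real) \<Rightarrow> real" where
  "kuhn_hat V a x =
     (\<Prod>v\<in>V. max 0 (1 - (x v - of_int (a v)))) * (\<Prod>v\<in>V. max 0 (1 + (x v - of_int (a v)))) *
     (\<Prod>v\<in>V. \<Prod>w\<in>V. max 0 (1 - (x v - of_int (a v)) + (x w - of_int (a w))))"

lemma kuhn_hat_nonneg: "0 \<le> kuhn_hat V a x"
  unfolding kuhn_hat_def by (intro mult_nonneg_nonneg prod_nonneg) auto

lemma kuhn_hat_pos_iff:
  assumes V: "finite V"
  shows "kuhn_hat V a x > 0 \<longleftrightarrow>
    (\<forall>v\<in>V. x v - of_int (a v) < 1 \<and> - 1 < x v - of_int (a v)) \<and>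
    (\<forall>v\<in>V. \<forall>w\<in>V. (x v - of_int (a v)) - (x w - of_int (a w)) < 1)" (is "_ \<longleftrightarrow> ?rhs")
proof -
  have max0: "max 0 r \<noteq> 0 \<longleftrightarrow> r > 0" for r :: real by auto
  have "kuhn_hat V a x > 0 \<longleftrightarrow> kuhn_hat V a x \<noteq> 0" using kuhn_hat_nonneg[of V a x] by linarith
  also have "\<dots> \<longleftrightarrow> (\<forall>v\<in>V. max 0 (1 - (x v - of_int (a v))) \<noteq> 0) \<and>
      (\<forall>v\<in>V. max 0 (1 + (x v - of_int (a v))) \<noteq> 0) \<and>
      (\<forall>v\<in>V. \<forall>w\<in>V. max 0 (1 - (x v - of_int (a v)) + (x w - of_int (a w))) \<noteq> 0)"
    unfolding kuhn_hat_def mult_eq_0_iff de_Morgan_disj prod_zero_iff[OF V] by blast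
  also have "\<dots> \<longleftrightarrow> ?rhs"
    by (simp only: max0) (auto simp: algebra_simps)
  finally show ?thesis .
qed

text \<open>
  Half-open intervals of length 1 that meet pairwise have a common point, the largest of their left end
  points.  Here this point is a threshold \<open>\<theta>\<close> with \<open>a = kuhn_vertex x \<theta>\<close>.
\<close>

lemma kuhn_hat_pos_iff_carrier:
  assumes V: "finite V" and x: "\<And>v. v \<notin> V \<Longrightarrow> x v = 0" and a: "\<And>v. v \<notin> V \<Longrightarrow> a v = 0"
  shows "kuhn_hat V a x > 0 \<longleftrightarrow> a \<in> kuhn_carrier x"
proof
  assume "a \<in> kuhn_carrier x"
  then obtain \<theta> where \<theta>: "0 \<le> \<theta>" "\<theta> < 1" "a = (\<lambda>v. \<lceil>x v - \<theta>\<rceil>)"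
    by (auto simp: kuhn_carrier_def kuhn_vertex_def)
  have "\<theta> - 1 < x v - of_int (a v)" "x v - of_int (a v) \<le> \<theta>" for v
    unfolding \<theta>(3) by linarith+
  then show "kuhn_hat V a x > 0" unfolding kuhn_hat_pos_iff[OF V] using \<theta>(1,2)
    by (smt (verit, best))
next
  assume h: "kuhn_hat V a x > 0"
  define d where "d = (\<lambda>v. x v - of_int (a v))"
  have d: "\<And>v. v \<in> V \<Longrightarrow> d v < 1 \<and> -1 < d v" "\<And>v w. v \<in> V \<Longrightarrow> w \<in> V \<Longrightarrow> d v - d w < 1"
    using h unfolding kuhn_hat_pos_iff[OF V] d_def by auto
  define \<theta> where "\<theta> = Max (insert 0 (d ` V))"
  have in1: "\<theta> \<in> insert 0 (d ` V)" unfolding \<theta>_def by (rule Max_in) (use V in auto)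
  have ge: "0 \<le> \<theta>" "\<And>v. v \<in> V \<Longrightarrow> d v \<le> \<theta>" unfolding \<theta>_def using V by auto
  have "a v = \<lceil>x v - \<theta>\<rceil>" for v
  proof (cases "v \<in> V")
    case True
    then have "d v \<le> \<theta>" "\<theta> < 1 + d v" using ge in1 d by force+
    then show ?thesis unfolding d_def by (simp add: eq_commute[of "a v"] ceiling_eq_iff)
  next
    case False
    have "\<theta> < 1" using in1 d by auto
    then show ?thesis using False x a ge(1) by (simp add: eq_commute[of 0] ceiling_eq_iff)
  qed
  moreover have "\<theta> < 1" using in1 d by auto
  ultimately have "a = kuhn_vertex x \<theta>" "\<theta> \<in> {0..<1}" using ge(1) by (auto simp: kuhn_vertex_def)
  then show "a \<in> kuhn_carrier x" unfolding kuhn_carrier_def by blast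
qed

lemma continuous_map_kuhn_hat:
  assumes "finite V" and "\<And>v. v \<in> V \<Longrightarrow> continuous_map X euclideanreal (\<lambda>x. F x v)"
  shows "continuous_map X euclideanreal (\<lambda>x. kuhn_hat V a (F x))"
  unfolding kuhn_hat_def
  by (intro continuous_intros assms) (use assms in auto)

text \<open>
  A point \<open>z\<close> of the simplex of mesh \<open>1/m\<close> around \<open>y\<close> arises from \<open>y\<close> by applying one and the same
  monotone step function to all coordinates, namely \<open>\<psi> r = (\<Sum>b. c b * \<lceil>m r - \<theta> b\<rceil>) / m\<close> where
  \<open>\<theta> b\<close> is the threshold of the vertex \<open>\<alpha> b\<close>.  It fixes 0 and 1 since \<open>\<lceil>k - \<theta>\<rceil> = k\<close> for integers \<open>k\<close> and
  \<open>0 \<le> \<theta> < 1\<close>.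
\<close>

lemma kuhn_combination:
  fixes y :: "'v \<Rightarrow> real" and c :: "'b \<Rightarrow> real" and \<alpha> :: "'b \<Rightarrow> 'v \<Rightarrow> int" and m :: nat
  assumes B: "finite B" and c0: "\<And>b. b \<in> B \<Longrightarrow> 0 \<le> c b" and c1: "sum c B = 1" and m: "0 < m"
    and \<alpha>: "\<And>b. b \<in> B \<Longrightarrow> \<alpha> b \<in> kuhn_carrier (\<lambda>v. real m * y v)"
  defines "z \<equiv> (\<lambda>v. (\<Sum>b\<in>B. c b * of_int (\<alpha> b v)) / real m)"
  shows kuhn_combination_eq_mono: "\<exists>\<psi>. mono \<psi> \<and> \<psi> 0 = 0 \<and> \<psi> 1 = 1 \<and> z = (\<lambda>v. \<psi> (y v))"
    and kuhn_combination_near: "\<bar>z v - y v\<bar> \<le> 1 / real m"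
    and card_kuhn_combination: "card (kuhn_carrier (\<lambda>v. real m * z v)) \<le> card B"
proof -
  have "\<forall>b\<in>B. \<exists>\<theta>. \<theta> \<in> {0..<1} \<and> \<alpha> b = kuhn_vertex (\<lambda>v. real m * y v) \<theta>"
    using \<alpha> unfolding kuhn_carrier_def by blast
  then obtain \<theta> where \<theta>: "\<And>b. b \<in> B \<Longrightarrow> \<theta> b \<in> {0..<1}"
    and \<alpha>\<theta>: "\<And>b. b \<in> B \<Longrightarrow> \<alpha> b = kuhn_vertex (\<lambda>v. real m * y v) (\<theta> b)"
    by metis
  define \<psi> where "\<psi> = (\<lambda>r. (\<Sum>b\<in>B. c b * of_int \<lceil>real m * r - \<theta> b\<rceil>) / real m)"
  have z: "z = (\<lambda>v. \<psi> (y v))"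
    unfolding z_def \<psi>_def by (auto simp: \<alpha>\<theta> kuhn_vertex_def intro!: sum.cong)
  have fix0: "\<lceil>real k - \<theta> b\<rceil> = int k" if "b \<in> B" for b and k :: nat
    using \<theta>[OF that] by (simp add: ceiling_eq_iff)
  have "mono \<psi>"
  proof (rule monoI)
    fix r s :: real assume "r \<le> s"
    then have "\<lceil>real m * r - \<theta> b\<rceil> \<le> \<lceil>real m * s - \<theta> b\<rceil>" for b
      using m by (intro ceiling_mono) (simp add: mult_left_mono)
    then show "\<psi> r \<le> \<psi> s"
      unfolding \<psi>_def using c0 by (intro divide_right_mono sum_mono mult_left_mono) auto
  qed
  moreover have "\<psi> 0 = 0" using fix0[of _ 0] by (simp add: \<psi>_def)
  moreover have "\<psi> 1 = 1"
    using fix0[of _ m] c1 m by (simp add: \<psi>_def flip: sum_distrib_right)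
  ultimately show "\<exists>\<psi>. mono \<psi> \<and> \<psi> 0 = 0 \<and> \<psi> 1 = 1 \<and> z = (\<lambda>v. \<psi> (y v))"
    using z by blast
  have "\<bar>(\<Sum>b\<in>B. c b * of_int \<lceil>real m * y v - \<theta> b\<rceil>) - real m * y v\<bar> \<le> 1"
  proof -
    have "(\<Sum>b\<in>B. c b * of_int \<lceil>real m * y v - \<theta> b\<rceil>) - real m * y v =
          (\<Sum>b\<in>B. c b * (of_int \<lceil>real m * y v - \<theta> b\<rceil> - real m * y v))"
      using c1 by (simp add: right_diff_distrib sum_subtractf flip: sum_distrib_right)
    also have "\<bar>\<dots>\<bar> \<le> (\<Sum>b\<in>B. c b * 1)"
    proof (rule order_trans[OF sum_abs], rule sum_mono)
      fix b assume b: "b \<in> B"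
      have "\<bar>of_int \<lceil>real m * y v - \<theta> b\<rceil> - real m * y v\<bar> \<le> 1"
        using \<theta>[OF b] le_of_int_ceiling[of "real m * y v - \<theta> b"]
          of_int_ceiling_diff_one_le[of "real m * y v - \<theta> b"]
        unfolding atLeastLessThan_iff by linarith
      then show "\<bar>c b * (of_int \<lceil>real m * y v - \<theta> b\<rceil> - real m * y v)\<bar> \<le> c b * 1"
        unfolding abs_mult using c0[OF b] by (simp add: mult_left_mono mult_left_le)
    qed
    finally show ?thesis using c1 by simp
  qed
  then have "\<bar>(\<Sum>b\<in>B. c b * of_int \<lceil>real m * y v - \<theta> b\<rceil>) - real m * y v\<bar> / real m \<le> 1 / real m"
    by (rule divide_right_mono) simp
  moreover have "z v - y v = ((\<Sum>b\<in>B. c b * of_int \<lceil>real m * y v - \<theta> b\<rceil>) - real m * y v) / real m"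
    using m by (simp add: z \<psi>_def field_simps)
  ultimately show "\<bar>z v - y v\<bar> \<le> 1 / real m" by simp
  have "(\<lambda>v. real m * z v) = (\<lambda>v. \<Sum>b\<in>B. c b * of_int \<lceil>real m * y v - \<theta> b\<rceil>)"
    using m by (simp add: z \<psi>_def)
  then have "kuhn_carrier (\<lambda>v. real m * z v) \<subseteq> (\<lambda>b. kuhn_vertex (\<lambda>v. real m * y v) (\<theta> b)) ` B"
    using kuhn_carrier_convex_combination[OF B c0 c1 \<theta>, where y = "\<lambda>v. real m * y v"] by simp
  then show "card (kuhn_carrier (\<lambda>v. real m * z v)) \<le> card B"
    using B by (meson card_image_le card_mono finite_imageI le_trans)
qed

lemma kuhn_carrier_bounds:
  fixes m :: nat
  assumes "a \<in> kuhn_carrier (\<lambda>v. real m * y v)" and "0 \<le> y v" "y v \<le> 1"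
  shows "0 \<le> a v \<and> a v \<le> int m"
proof -
  obtain \<theta> where \<theta>: "0 \<le> \<theta>" "\<theta> < 1" "a v = \<lceil>real m * y v - \<theta>\<rceil>"
    using assms(1) by (auto simp: kuhn_carrier_def kuhn_vertex_def)
  have "0 \<le> real m * y v" "real m * y v \<le> real m" using assms by (auto intro: mult_left_le)
  then show ?thesis unfolding \<theta>(3) using \<theta>(1,2) by (auto simp: ceiling_le_iff le_ceiling_iff)
qed

lemma kuhn_carrier_zero:
  assumes "a \<in> kuhn_carrier x" "x v = 0"
  shows "a v = 0"
  using assms by (auto simp: kuhn_carrier_def kuhn_vertex_def ceiling_eq_iff)

lemma kuhn_star_small:
  assumes V: "finite V" and m: "0 < m" and v: "v \<in> V"
    and "0 < kuhn_hat V a (\<lambda>v. m * x v)" "0 < kuhn_hat V a (\<lambda>v. m * y v)"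
  shows "\<bar>x v - y v\<bar> < 2 / m"
proof -
  have "m * \<bar>x v - y v\<bar> = \<bar>m * x v - m * y v\<bar>"
    using m by (simp add: abs_mult flip: right_diff_distrib)
  also have "\<dots> < 2"
    using assms(4,5) v unfolding kuhn_hat_pos_iff[OF V] by (smt (verit))
  finally show ?thesis using m by (simp add: field_simps)
qed

section \<open>Retractions onto subcomplexes of a cube\<close>

text \<open>
  This property makes \<open>P\<close> a subcomplex of the Kuhn triangulations of all meshes \<open>1/m\<close>, by
  \<open>kuhn_combination_eq_mono\<close>.  It holds for sets described by comparisons of coordinates with each
  other and with 0 and 1.
\<close>

definition order_closed :: "('v \<Rightarrow> real) set \<Rightarrow> bool" where
  "order_closed P \<longleftrightarrow>
     (\<forall>y\<in>P. \<forall>\<psi>. mono \<psi> \<and> \<psi> 0 = 0 \<and> \<psi> 1 = 1 \<longrightarrow> (\<lambda>v. \<psi> (y v)) \<in> P)"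

text \<open>
  A retraction of \<open>Z\<close> onto a copy of \<open>P = U ` Z\<close>.  If \<open>j\<close> denotes the inverse of \<open>U\<close> from \<open>P\<close> to that copy, then
  \<open>U \<circ> j\<close> is the identity of \<open>P\<close> and \<open>R = j \<circ> U\<close>.  The map \<open>j\<close> is encoded by \<open>R\<close>: the kernel condition makes it
  well defined, and on a compact space it is continuous by \<open>cube_retraction_lift\<close>.
\<close>

definition cube_retraction ::
  "'a topology \<Rightarrow> 'v set \<Rightarrow> ('a \<Rightarrow> 'v \<Rightarrow> real) \<Rightarrow> ('a \<Rightarrow> 'a) \<Rightarrow> bool" where
  "cube_retraction Z V U R \<longleftrightarrow> finite V \<and>
     (\<forall>v. continuous_map Z euclideanreal (\<lambda>z. U z v)) \<and> continuous_map Z Z R \<and>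
     (\<forall>z\<in>topspace Z. \<forall>v. 0 \<le> U z v \<and> U z v \<le> 1 \<and> (v \<notin> V \<longrightarrow> U z v = 0)) \<and>
     (\<forall>z\<in>topspace Z. \<forall>z'\<in>topspace Z. U z = U z' \<longrightarrow> R z = R z') \<and>
     (\<forall>z\<in>topspace Z. U (R z) = U z) \<and> order_closed (U ` topspace Z)"

lemma cube_retractionD:
  assumes "cube_retraction Z V U R"
  shows "finite V" "\<And>v. continuous_map Z euclideanreal (\<lambda>z. U z v)" "continuous_map Z Z R"
    "\<And>z v. z \<in> topspace Z \<Longrightarrow> 0 \<le> U z v" "\<And>z v. z \<in> topspace Z \<Longrightarrow> U z v \<le> 1"
    "\<And>z v. z \<in> topspace Z \<Longrightarrow> v \<notin> V \<Longrightarrow> U z v = 0"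
    "\<And>z z'. z \<in> topspace Z \<Longrightarrow> z' \<in> topspace Z \<Longrightarrow> U z = U z' \<Longrightarrow> R z = R z'"
    "\<And>z. z \<in> topspace Z \<Longrightarrow> U (R z) = U z" "order_closed (U ` topspace Z)"
    "\<And>z. z \<in> topspace Z \<Longrightarrow> R z \<in> topspace Z"
proof -
  note C = assms[unfolded cube_retraction_def]
  show "finite V" "\<And>v. continuous_map Z euclideanreal (\<lambda>z. U z v)" "continuous_map Z Z R"
    "order_closed (U ` topspace Z)"
    using C by simp_all
  show "\<And>z v. z \<in> topspace Z \<Longrightarrow> 0 \<le> U z v" "\<And>z v. z \<in> topspace Z \<Longrightarrow> U z v \<le> 1"
    "\<And>z v. z \<in> topspace Z \<Longrightarrow> v \<notin> V \<Longrightarrow> U z v = 0"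
    using C by simp_all
  have "\<forall>z\<in>topspace Z. \<forall>z'\<in>topspace Z. U z = U z' \<longrightarrow> R z = R z'"
    using C by (elim conjE) assumption
  then show "\<And>z z'. z \<in> topspace Z \<Longrightarrow> z' \<in> topspace Z \<Longrightarrow> U z = U z' \<Longrightarrow> R z = R z'"
    by metis
  have "\<forall>z\<in>topspace Z. U (R z) = U z" using C by (elim conjE) assumption
  then show "\<And>z. z \<in> topspace Z \<Longrightarrow> U (R z) = U z" by (rule bspec)
  have "R \<in> topspace Z \<rightarrow> topspace Z"
    by (rule continuous_map_funspace) (use C in simp)
  then show "\<And>z. z \<in> topspace Z \<Longrightarrow> R z \<in> topspace Z" by (rule funcset_mem)
qed

text \<open>
  Uniform continuity of \<open>j\<close> on \<open>P\<close>, expressed by \<open>U\<close> and \<open>R\<close>.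
\<close>

lemma cube_retraction_uniform:
  assumes comp: "compact_space (mtopology_of X)"
    and U: "cube_retraction (mtopology_of X) V U R" and "0 < \<epsilon>"
  shows "\<exists>\<sigma>>0. \<forall>x\<in>mspace X. \<forall>y\<in>mspace X. (\<forall>v\<in>V. \<bar>U x v - U y v\<bar> < \<sigma>) \<longrightarrow> mdist X (R x) (R y) < \<epsilon>"
proof -
  let ?M = "mtopology_of X"
  note U' = cube_retractionD[OF U]
  have "\<exists>J \<sigma>. finite J \<and> J \<subseteq> V \<and> 0 < \<sigma> \<and> (\<forall>z\<in>topspace (prod_topology ?M ?M).
      (\<forall>v\<in>J. \<bar>U (fst z) v - U (snd z) v\<bar> < \<sigma>) \<longrightarrow> mdist X (R (fst z)) (R (snd z)) < \<epsilon>)"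
  proof (rule compact_space_uniform_bound)
    show "compact_space (prod_topology ?M ?M)" using comp by (simp add: compact_space_prod_topology)
    show "continuous_map (prod_topology ?M ?M) euclideanreal (\<lambda>z. \<bar>U (fst z) v - U (snd z) v\<bar>)" for v
      using continuous_map_compose[OF continuous_map_fst U'(2), of ?M] continuous_map_compose[OF continuous_map_snd U'(2), of ?M]
      by (intro continuous_map_real_abs continuous_map_diff) (simp_all add: o_def)
    show "continuous_map (prod_topology ?M ?M) euclideanreal (\<lambda>z. mdist X (R (fst z)) (R (snd z)))"
      using continuous_map_compose[OF continuous_map_fst U'(3), of ?M] continuous_map_compose[OF continuous_map_snd U'(3), of ?M]
      by (intro continuous_map_mdist) (simp_all add: o_def)
    fix z assume z: "z \<in> topspace (prod_topology ?M ?M)"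
      and eq: "\<And>v. v \<in> V \<Longrightarrow> \<bar>U (fst z) v - U (snd z) v\<bar> \<le> 0"
    have zz: "fst z \<in> topspace ?M" "snd z \<in> topspace ?M" using z by auto
    have "U (fst z) v = U (snd z) v" for v
      using eq[of v] U'(6)[OF zz(1), of v] U'(6)[OF zz(2), of v] by (cases "v \<in> V") auto
    then have "R (fst z) = R (snd z)" by (intro U'(7) zz) auto
    then show "mdist X (R (fst z)) (R (snd z)) < \<epsilon>" using U'(10)[OF zz(2)] \<open>0 < \<epsilon>\<close> by (simp add: mdist_self)
  qed
  then obtain J \<sigma> where J: "J \<subseteq> V" "0 < \<sigma>" and
    *: "\<And>z. z \<in> topspace (prod_topology ?M ?M) \<Longrightarrow> \<forall>v\<in>J. \<bar>U (fst z) v - U (snd z) v\<bar> < \<sigma> \<Longrightarrow>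
       mdist X (R (fst z)) (R (snd z)) < \<epsilon>"
    by (elim exE conjE) blast
  show ?thesis
  proof (intro exI[of _ \<sigma>] conjI J(2) ballI impI)
    fix x y assume xy: "x \<in> mspace X" "y \<in> mspace X" and lt: "\<forall>v\<in>V. \<bar>U x v - U y v\<bar> < \<sigma>"
    have "\<forall>v\<in>J. \<bar>U (fst (x, y)) v - U (snd (x, y)) v\<bar> < \<sigma>" using lt J(1) by auto
    then show "mdist X (R x) (R y) < \<epsilon>" using *[of "(x, y)"] xy by simp
  qed
qed

lemma cube_retraction_lift:
  assumes comp: "compact_space Z" and U: "cube_retraction Z V U R"
  shows "\<exists>j. continuous_map (subtopology (powertop_real UNIV) (U ` topspace Z)) Z j \<and>
    (\<forall>z\<in>topspace Z. j (U z) = R z)"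
proof -
  note U' = cube_retractionD[OF U]
  let ?P = "subtopology (powertop_real UNIV) (U ` topspace Z)"
  have "continuous_map Z (powertop_real UNIV) U"
    using U'(2) by (simp add: continuous_map_componentwise_UNIV)
  then have cU: "continuous_map Z ?P U" by (simp add: continuous_map_in_subtopology)
  have "Hausdorff_space ?P"
    by (intro Hausdorff_space_subtopology) (simp add: Hausdorff_space_product_topology)
  then have "quotient_map Z ?P U"
    by (intro continuous_imp_quotient_map cU comp) auto
  then show ?thesis by (rule quotient_map_factor[OF _ U'(3) U'(7)])
qed

text \<open>
  The map is \<open>g = j \<circ> z\<close>, where \<open>z x\<close> is a convex combination of vertices \<open>\<alpha> b\<close> in one simplex of mesh
  \<open>1/m\<close>, weighted by how much the hats \<open>w b\<close> of the finer mesh \<open>1/k\<close> exceed \<open>\<eta>\<close>.  The vertex map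
  \<open>\<alpha>\<close> is a simplicial approximation of \<open>U \<circ> f \<circ> j\<close>.  The steps from \<open>f x\<close> over
  \<open>f (R x)\<close> and \<open>R (f (R x))\<close> to \<open>g x\<close> cost a quarter of \<open>\<epsilon>\<close> each, and so do the steps from \<open>x\<close> over
  \<open>R x\<close> and \<open>R y\<close> to \<open>y\<close> that bound the diameter of the set where a fine hat is positive.
\<close>

lemma robust_approximation:
  fixes U :: "'a \<Rightarrow> 'v \<Rightarrow> real"
  assumes comp: "compact_space (mtopology_of X)"
    and model: "\<And>\<epsilon>. \<epsilon> > 0 \<Longrightarrow> \<exists>(V::'v set) U R. cube_retraction (mtopology_of X) V U R \<and>
        (\<forall>x\<in>mspace X. mdist X (R x) x < \<epsilon>)"
    and f: "continuous_map (mtopology_of X) (mtopology_of X) f" and \<epsilon>: "0 < \<epsilon>"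
  shows "\<exists>g. continuous_map (mtopology_of X) (mtopology_of X) g \<and>
          (\<forall>x\<in>mspace X. mdist X (f x) (g x) < \<epsilon>) \<and> robust_chain_cover X \<epsilon> g"
proof -
  let ?M = "mtopology_of X"
  interpret Metric_space "mspace X" "mdist X" by simp
  have fM: "f x \<in> mspace X" if "x \<in> mspace X" for x
    using continuous_map_funspace[OF f] that by auto
  obtain \<delta>1 where \<delta>1: "\<delta>1 > 0" "\<And>x y. x \<in> mspace X \<Longrightarrow> y \<in> mspace X \<Longrightarrow> mdist X x y < \<delta>1 \<Longrightarrow> mdist X (f x) (f y) < \<epsilon> / 4"
    using compact_metric_uniformly_continuous[OF comp f, of "\<epsilon> / 4"] \<epsilon> by auto
  obtain V :: "'v set" and U R where cr: "cube_retraction ?M V U R"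
    and near: "\<forall>x\<in>mspace X. mdist X (R x) x < min \<delta>1 (\<epsilon> / 4)"
    using model[of "min \<delta>1 (\<epsilon> / 4)"] \<delta>1(1) \<epsilon> by auto
  note U = cube_retractionD[OF cr, simplified]
  have near1: "mdist X (R x) x < \<delta>1" "mdist X (R x) x < \<epsilon> / 4" if "x \<in> mspace X" for x
    using near that by auto
  have uniform: "\<exists>m::nat. 0 < m \<and> (\<forall>x\<in>mspace X. \<forall>y\<in>mspace X. (\<forall>v\<in>V. \<bar>U x v - U y v\<bar> \<le> 2 / real m) \<longrightarrow> mdist X (R x) (R y) < e)"
    if e: "0 < e" for e
  proof -
    obtain \<sigma> where \<sigma>: "0 < \<sigma>" "\<And>x y. x \<in> mspace X \<Longrightarrow> y \<in> mspace X \<Longrightarrow> \<forall>v\<in>V. \<bar>U x v - U y v\<bar> < \<sigma> \<Longrightarrow> mdist X (R x) (R y) < e"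
      using cube_retraction_uniform[OF comp cr e] by blast
    obtain m where m: "1 / real (Suc m) < \<sigma> / 2" using nat_approx_posE[of "\<sigma> / 2"] \<sigma>(1) by auto
    then have "2 / real (Suc m) < \<sigma>" by simp
    show ?thesis
    proof (intro exI[of _ "Suc m"] conjI ballI impI)
      fix x y assume xy: "x \<in> mspace X" "y \<in> mspace X"
        and le: "\<forall>v\<in>V. \<bar>U x v - U y v\<bar> \<le> 2 / real (Suc m)"
      have "\<forall>v\<in>V. \<bar>U x v - U y v\<bar> < \<sigma>"
        using le \<open>2 / real (Suc m) < \<sigma>\<close> by (meson le_less_trans)
      then show "mdist X (R x) (R y) < e" by (rule \<sigma>(2)[OF xy])
    qed simp
  qed
  obtain m :: nat where m: "0 < m" "\<And>x y. x \<in> mspace X \<Longrightarrow> y \<in> mspace X \<Longrightarrow>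
      \<forall>v\<in>V. \<bar>U x v - U y v\<bar> \<le> 2 / real m \<Longrightarrow> mdist X (R x) (R y) < \<epsilon> / 4"
    using uniform[of "\<epsilon> / 4"] \<epsilon> by (metis divide_pos_pos zero_less_numeral)
  have Uhat: "continuous_map ?M euclideanreal (\<lambda>x. kuhn_hat V a (\<lambda>v. k * U x v))" for a k
    by (intro continuous_map_kuhn_hat continuous_map_real_mult_left U)
  have hat_carrier: "0 < kuhn_hat V a (\<lambda>v. k * U x v) \<longleftrightarrow> a \<in> kuhn_carrier (\<lambda>v. k * U x v)"
    if "x \<in> mspace X" "\<And>v. v \<notin> V \<Longrightarrow> a v = 0" for a k x
    using that U(1) U(6)[OF that(1)] by (intro kuhn_hat_pos_iff_carrier) auto
  have carrier_V: "a v = 0" if "a \<in> kuhn_carrier (\<lambda>v. k * U x v)" "x \<in> mspace X" "v \<notin> V" for a k x v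
    using kuhn_carrier_zero[OF that(1)] U(6) that by simp
  have kuhn_vertex_mem: "kuhn_vertex y 0 \<in> kuhn_carrier y" for y :: "'v \<Rightarrow> real"
    by (auto simp: kuhn_carrier_def)
  \<comment> \<open>The preimages under \<open>U \<circ> f\<close> of the open stars of the coarse mesh \<open>1/m\<close> cover the space; the fine mesh is
     chosen so that \<open>j\<close> maps each fine star into a set smaller than the Lebesgue number of this cover.\<close>
  define A where "A = {a :: 'v \<Rightarrow> int. \<forall>v. v \<notin> V \<longrightarrow> a v = 0}"
  define star where "star = (\<lambda>a. {x \<in> topspace ?M. kuhn_hat V a (\<lambda>v. real m * U (f x) v) \<in> {0<..}})"
  have "openin mtopology (star a)" for a
  proof -
    have "continuous_map ?M euclideanreal (\<lambda>x. kuhn_hat V a (\<lambda>v. real m * U (f x) v))"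
      using continuous_map_compose[OF f Uhat, of a "real m"] by (simp add: o_def)
    then have "openin ?M (star a)"
      unfolding star_def by (rule openin_continuous_map_preimage) auto
    then show ?thesis by (simp add: mtopology_of_def)
  qed
  moreover have "mspace X \<subseteq> \<Union>(star ` A)"
  proof
    fix x assume x: "x \<in> mspace X"
    let ?a = "kuhn_vertex (\<lambda>v. real m * U (f x) v) 0"
    have a: "?a \<in> kuhn_carrier (\<lambda>v. real m * U (f x) v)" by (rule kuhn_vertex_mem)
    then have "?a \<in> A" using carrier_V[OF a fM[OF x]] by (simp add: A_def)
    moreover have "x \<in> star ?a"
      using hat_carrier[OF fM[OF x], of ?a "real m"] a x carrier_V[OF a fM[OF x]] by (simp add: star_def)
    ultimately show "x \<in> \<Union>(star ` A)" by blast
  qed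
  moreover have "compactin mtopology (mspace X)"
    using comp by (simp add: mtopology_of_def compact_space_def)
  ultimately have "\<exists>\<delta>>0. \<forall>x\<in>mspace X. \<exists>U\<in>star ` A. mball x \<delta> \<subseteq> U"
    by (intro lebesgue_number) auto
  then obtain \<delta> where \<delta>: "\<delta> > 0" "\<And>x. x \<in> mspace X \<Longrightarrow> \<exists>a\<in>A. mball x \<delta> \<subseteq> star a"
    by auto
  obtain M :: nat where M: "0 < M" "\<And>x y. x \<in> mspace X \<Longrightarrow> y \<in> mspace X \<Longrightarrow>
      \<forall>v\<in>V. \<bar>U x v - U y v\<bar> \<le> 2 / real M \<Longrightarrow> mdist X (R x) (R y) < min \<delta> (\<epsilon> / 4)"
    using uniform[of "min \<delta> (\<epsilon> / 4)"] \<epsilon> \<delta>(1) by (metis divide_pos_pos zero_less_numeral min_less_iff_conj)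
  define k where "k = M * m"
  have k: "0 < k" "real k = real M * real m" using M m by (auto simp: k_def)
  define B where "B = {b :: 'v \<Rightarrow> int. \<forall>v. (v \<in> V \<longrightarrow> b v \<in> {0..int k}) \<and> (v \<notin> V \<longrightarrow> b v = 0)}"
  have finB: "finite B" unfolding B_def by (rule finite_set_of_finite_funs) (use U(1) in auto)
  define w where "w = (\<lambda>b x. kuhn_hat V b (\<lambda>v. real k * U x v))"
  have cw: "continuous_map ?M euclideanreal (w b)" for b unfolding w_def by (rule Uhat)
  have B_carrier: "kuhn_carrier (\<lambda>v. real k * U x v) \<subseteq> B" if "x \<in> mspace X" for x
    using kuhn_carrier_bounds[of _ k "U x"] carrier_V[of _ "real k" x] U(4,5)[OF that] that
    by (auto simp: B_def)
  have w_carrier: "0 < w b x \<longleftrightarrow> b \<in> kuhn_carrier (\<lambda>v. real k * U x v)" if "x \<in> mspace X" "b \<in> B" for b x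
    unfolding w_def using that by (intro hat_carrier) (auto simp: B_def)
  have w_nonneg: "0 \<le> w b x" for b x by (simp add: w_def kuhn_hat_nonneg)
  have star_small: "mdist X (R x) (R y) < min \<delta> (\<epsilon> / 4)"
    if "x \<in> mspace X" "y \<in> mspace X" "0 < w b x" "0 < w b y" for b x y
  proof (rule M(2)[OF that(1,2)], rule ballI)
    fix v assume v: "v \<in> V"
    have "\<bar>U x v - U y v\<bar> < 2 / real k"
      using kuhn_star_small[OF U(1) _ v, of "real k" b] that k by (simp add: w_def)
    also have "\<dots> \<le> 2 / real M" using M m by (intro divide_left_mono) (auto simp: k_def)
    finally show "\<bar>U x v - U y v\<bar> \<le> 2 / real M" by simp
  qed
  \<comment> \<open>The simplicial approximation condition: \<open>U \<circ> f \<circ> j\<close> maps the fine star of \<open>b\<close> into the coarse star of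
     \<open>\<alpha> b\<close>.  Thus for \<open>w b x > 0\<close> all \<open>\<alpha> b\<close> are vertices of the coarse simplex around \<open>U (f (R x))\<close>.\<close>
  have "\<exists>a\<in>A. \<forall>x\<in>mspace X. 0 < w b x \<longrightarrow> R x \<in> star a" for b
  proof (cases "\<exists>x\<in>mspace X. 0 < w b x")
    case True
    then obtain x0 where x0: "x0 \<in> mspace X" "0 < w b x0" by blast
    obtain a where a: "a \<in> A" "mball (R x0) \<delta> \<subseteq> star a" using \<delta>(2)[OF U(10)[OF x0(1)]] by blast
    have "R x \<in> star a" if "x \<in> mspace X" "0 < w b x" for x
      using star_small[OF x0(1) that(1) x0(2) that(2)] a(2) U(10) x0(1) that(1) by auto
    then show ?thesis using a(1) by blast
  next
    case False
    then show ?thesis by (auto simp: A_def)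
  qed
  then obtain \<alpha> where \<alpha>A: "\<And>b. \<alpha> b \<in> A"
    and \<alpha>: "\<And>b x. x \<in> mspace X \<Longrightarrow> 0 < w b x \<Longrightarrow> R x \<in> star (\<alpha> b)"
    by metis
  have \<alpha>_carrier: "\<alpha> b \<in> kuhn_carrier (\<lambda>v. real m * U (f (R x)) v)" if "x \<in> mspace X" "0 < w b x" for b x
    using \<alpha>[OF that] hat_carrier[OF fM[OF U(10)[OF that(1)]], of "\<alpha> b" "real m"] \<alpha>A[of b]
    by (simp add: star_def A_def)
  \<comment> \<open>By compactness the hats have a positive lower bound \<open>\<sigma>\<close> for their sum, so that the largest hat stays
     above \<open>\<sigma>\<close> divided by their number; dividing by one more makes the inequality strict.\<close>
  have "\<exists>\<sigma>>0. \<forall>x\<in>topspace ?M. (\<Sum>b\<in>B. w b x) < \<sigma> \<longrightarrow> (1::real) < 1"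
  proof (rule compact_space_uniformly_small[OF comp])
    show "continuous_map ?M euclideanreal (\<lambda>x. \<Sum>b\<in>B. w b x)" by (intro continuous_map_sum finB cw)
    fix x assume x: "x \<in> topspace ?M" "(\<Sum>b\<in>B. w b x) \<le> 0"
    let ?b = "kuhn_vertex (\<lambda>v. real k * U x v) 0"
    have "?b \<in> kuhn_carrier (\<lambda>v. real k * U x v)" by (rule kuhn_vertex_mem)
    then have "?b \<in> B" "0 < w ?b x" using B_carrier w_carrier x by auto
    then have "0 < (\<Sum>b\<in>B. w b x)" using finB w_nonneg by (intro sum_pos2[of B ?b]) auto
    then show "(1::real) < 1" using x by simp
  qed simp
  then obtain \<sigma> where \<sigma>: "\<sigma> > 0" "\<And>x. x \<in> mspace X \<Longrightarrow> \<sigma> \<le> (\<Sum>b\<in>B. w b x)"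
    by (auto simp: not_less)
  define \<eta> where "\<eta> = \<sigma> / (real (card B) + 1)"
  have \<eta>: "0 < \<eta>" using \<sigma> by (simp add: \<eta>_def)
  have some: "\<exists>b\<in>B. \<eta> < w b x" if x: "x \<in> mspace X" for x
  proof (rule ccontr)
    assume "\<not> ?thesis"
    then have "(\<Sum>b\<in>B. w b x) \<le> real (card B) * \<eta>"
      by (intro sum_bounded_above) auto
    also have "\<dots> < \<sigma>" using \<sigma>(1) by (simp add: \<eta>_def field_simps)
    finally show False using \<sigma>(2)[OF x] by simp
  qed
  define s where "s = (\<lambda>x. \<Sum>b\<in>B. max 0 (w b x - \<eta>))"
  have s_pos: "0 < s x" if "x \<in> mspace X" for x
  proof -
    obtain b where "b \<in> B" "\<eta> < w b x" using some[OF \<open>x \<in> mspace X\<close>] by blast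
    then show ?thesis unfolding s_def using finB by (intro sum_pos2[of B b]) auto
  qed
  have s_ne: "(\<Sum>b\<in>B. max 0 (w b x - \<eta>)) \<noteq> 0" if "x \<in> mspace X" for x
    using s_pos[OF that] by (simp add: s_def)
  define c where "c = (\<lambda>b x. max 0 (w b x - \<eta>) / s x)"
  define z where "z = (\<lambda>x v. (\<Sum>b\<in>B. c b x * of_int (\<alpha> b v)) / real m)"
  have z_props: "(\<exists>\<psi>. mono \<psi> \<and> \<psi> 0 = 0 \<and> \<psi> 1 = 1 \<and> z x = (\<lambda>v. \<psi> (U (f (R x)) v))) \<and>
      (\<forall>v. \<bar>z x v - U (f (R x)) v\<bar> \<le> 1 / real m) \<and>
      card (kuhn_carrier (\<lambda>v. real m * z x v)) \<le> card {b \<in> B. \<eta> \<le> w b x}"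
    if x: "x \<in> mspace X" for x
  proof -
    let ?B = "{b \<in> B. \<eta> < w b x}"
    have B': "finite ?B" using finB by simp
    have c_out: "c b x = 0" if "b \<in> B - ?B" for b using that by (auto simp: c_def)
    have "sum (\<lambda>b. c b x) B = 1"
      using s_pos[OF x] by (simp add: c_def s_def flip: sum_divide_distrib)
    then have c1: "sum (\<lambda>b. c b x) ?B = 1"
      using sum.mono_neutral_right[OF finB, of ?B "\<lambda>b. c b x"] c_out by auto
    have c0: "0 \<le> c b x" for b using s_pos[OF x] by (simp add: c_def)
    have z: "z x = (\<lambda>v. (\<Sum>b\<in>?B. c b x * of_int (\<alpha> b v)) / real m)"
      unfolding z_def using c_out
      by (intro ext arg_cong[where f="\<lambda>r. r / real m"] sum.mono_neutral_right finB) auto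
    have mem: "\<alpha> b \<in> kuhn_carrier (\<lambda>v. real m * U (f (R x)) v)" if "b \<in> ?B" for b
      using that \<eta> by (intro \<alpha>_carrier[OF x]) auto
    have "card ?B \<le> card {b \<in> B. \<eta> \<le> w b x}" using finB by (intro card_mono) auto
    moreover have "card (kuhn_carrier (\<lambda>v. real m * z x v)) \<le> card ?B"
      unfolding z by (rule card_kuhn_combination[where \<alpha> = \<alpha>, OF B' c0 c1 m(1) mem])
    moreover have "\<exists>\<psi>. mono \<psi> \<and> \<psi> 0 = 0 \<and> \<psi> 1 = 1 \<and> z x = (\<lambda>v. \<psi> (U (f (R x)) v))"
      unfolding z by (rule kuhn_combination_eq_mono[where \<alpha> = \<alpha>, OF B' c0 c1 m(1) mem])
    moreover have "\<bar>z x v - U (f (R x)) v\<bar> \<le> 1 / real m" for v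
      unfolding z by (rule kuhn_combination_near[where \<alpha> = \<alpha>, OF B' c0 c1 m(1) mem])
    ultimately show ?thesis by (intro conjI allI) (blast intro: le_trans)+
  qed
  have z_in: "z x \<in> U ` mspace X" if x: "x \<in> mspace X" for x
  proof -
    obtain \<psi> where "mono \<psi>" "\<psi> 0 = 0" "\<psi> 1 = 1" and zx: "z x = (\<lambda>v. \<psi> (U (f (R x)) v))"
      using z_props[OF x] by blast
    moreover have "U (f (R x)) \<in> U ` mspace X" using U(10) fM x by blast
    ultimately show ?thesis using U(9) unfolding order_closed_def zx by blast
  qed
  obtain j where j: "continuous_map (subtopology (powertop_real UNIV) (U ` mspace X)) ?M j"
    "\<And>x. x \<in> mspace X \<Longrightarrow> j (U x) = R x"
    using cube_retraction_lift[OF comp cr] by auto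
  have "continuous_map ?M euclideanreal (\<lambda>x. z x v)" for v
    unfolding z_def c_def s_def
    by (intro continuous_intros finB cw) (use s_ne m(1) in auto)
  then have "continuous_map ?M (subtopology (powertop_real UNIV) (U ` mspace X)) z"
    using z_in by (auto simp: continuous_map_in_subtopology continuous_map_componentwise_UNIV)
  then have cg: "continuous_map ?M ?M (j \<circ> z)" using j(1) by (rule continuous_map_compose)
  have g_rep: "\<exists>x'\<in>mspace X. U x' = z x \<and> (j \<circ> z) x = R x'" if "x \<in> mspace X" for x
    using z_in[OF that] j(2) by (metis (no_types, lifting) comp_apply image_iff)
  have gM: "(j \<circ> z) \<in> mspace X \<rightarrow> mspace X" using g_rep U(10) by fastforce
  have "mdist X (f x) ((j \<circ> z) x) < \<epsilon>" if x: "x \<in> mspace X" for x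
  proof -
    obtain x' where x': "x' \<in> mspace X" "U x' = z x" "(j \<circ> z) x = R x'" using g_rep[OF x] by blast
    let ?y = "f (R x)"
    have y: "R x \<in> mspace X" "?y \<in> mspace X" "R ?y \<in> mspace X" "f x \<in> mspace X" "R x' \<in> mspace X"
      using x x' U(10) fM by auto
    have "mdist X (f x) ?y < \<epsilon> / 4" using \<delta>1(2)[of x "R x"] near1(1)[OF x] x y mdist_commute by metis
    moreover have "mdist X ?y (R ?y) < \<epsilon> / 4" using near1(2)[of ?y] y mdist_commute by metis
    moreover have "mdist X (R ?y) (R x') < \<epsilon> / 4"
    proof (rule m(2)[OF y(2) x'(1)], rule ballI)
      fix v assume "v \<in> V"
      have "\<bar>z x v - U ?y v\<bar> \<le> 1 / real m" using z_props[OF x] by blast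
      moreover have "1 / real m \<le> 2 / real m" by (simp add: divide_right_mono)
      ultimately show "\<bar>U ?y v - U x' v\<bar> \<le> 2 / real m" using x'(2) by (simp add: abs_minus_commute)
    qed
    moreover have "mdist X (f x) (R x') \<le> mdist X (f x) ?y + mdist X ?y (R ?y) + mdist X (R ?y) (R x')"
      using mdist_triangle[of "f x" X ?y "R x'"] mdist_triangle[of ?y X "R ?y" "R x'"] y by linarith
    ultimately show ?thesis unfolding x'(3) using \<epsilon> by linarith
  qed
  moreover have "robust_chain_cover X \<epsilon> (j \<circ> z)"
  proof (rule robust_chain_cover_of_weights[OF comp finB cw gM \<eta>])
    show "\<exists>b\<in>B. \<eta> \<le> w b x" if "x \<in> mspace X" for x using some[OF that] by (meson less_imp_le)
    show "card {b \<in> B. 0 < w b ((j \<circ> z) x)} \<le> card {b \<in> B. \<eta> \<le> w b x}" if x: "x \<in> mspace X" for x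
    proof -
      obtain x' where x': "x' \<in> mspace X" "U x' = z x" "(j \<circ> z) x = R x'" using g_rep[OF x] by blast
      have Uz: "U ((j \<circ> z) x) = z x" using x' U(8) by simp
      \<comment> \<open>fine hats at \<open>g x\<close>, then fine vertices around \<open>z x\<close>, then coarse vertices, then hats above \<open>\<eta>\<close> at \<open>x\<close>\<close>
      have "{b \<in> B. 0 < w b ((j \<circ> z) x)} = kuhn_carrier (\<lambda>v. real k * z x v)"
      proof -
        have "(j \<circ> z) x \<in> mspace X" using gM x by (rule funcset_mem)
        then show ?thesis
          using w_carrier[of "(j \<circ> z) x"] B_carrier[of "(j \<circ> z) x"] unfolding Uz by blast
      qed
      moreover have "range (\<lambda>v. real m * z x v) \<subseteq> insert 0 ((\<lambda>v. real m * z x v) ` V)"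
      proof
        fix r assume "r \<in> range (\<lambda>v. real m * z x v)"
        then obtain v where "r = real m * z x v" by blast
        then show "r \<in> insert 0 ((\<lambda>v. real m * z x v) ` V)"
          using U(6)[OF x'(1), of v] x'(2) by (cases "v \<in> V") auto
      qed
      then have "finite (range (\<lambda>v. real m * z x v))" using U(1) by (auto intro: finite_subset)
      then have "card (kuhn_carrier (\<lambda>v. real M * (real m * z x v))) \<le> card (kuhn_carrier (\<lambda>v. real m * z x v))"
        by (rule card_kuhn_carrier_multiple_le)
      ultimately show ?thesis using z_props[OF x] by (simp add: k(2) mult.assoc)
    qed
    show "mdist X x y < \<epsilon>" if "b \<in> B" "x \<in> mspace X" "y \<in> mspace X" "0 < w b x" "0 < w b y" for b x y
    proof -
      have "mdist X (R x) (R y) < \<epsilon> / 4" using star_small[OF that(2-5)] by simp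
      moreover have "mdist X (R x) x < \<epsilon> / 4" "mdist X (R y) y < \<epsilon> / 4" using near1(2) that by auto
      moreover have "mdist X x y \<le> mdist X (R x) x + mdist X (R x) (R y) + mdist X (R y) y"
        using mdist_triangle[of x X "R x" y] mdist_triangle[of "R x" X "R y" y] U(10) that
          mdist_commute[of X x "R x"] by auto
      ultimately show ?thesis using \<epsilon> by linarith
    qed
  qed
  ultimately show ?thesis using cg by blast
qed

theorem zero_CR_of_cube_retractions:
  assumes comp: "compact_space (mtopology_of X)"
    and model: "\<And>\<epsilon>. \<epsilon> > 0 \<Longrightarrow> \<exists>(V::'v set) U R. cube_retraction (mtopology_of X) V U R \<and>
        (\<forall>x\<in>mspace X. mdist X (R x) x < \<epsilon>)"
  shows "X \<in> zero_CR"
  by (rule zero_CR_of_dense_robust[OF comp robust_approximation[OF comp model]])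

section \<open>Polyhedra as subcomplexes of a cube\<close>

text \<open>
  The tail sums of nonnegative multiples of the points of a simplicial complex \<open>K\<close> with vertices below
  \<open>N\<close>.  The coordinate of a point at the vertex \<open>k\<close> is the drop \<open>q k - q (Suc k)\<close>, and \<open>q 0\<close> is
  the sum of its coordinates.
\<close>

definition ordered_cone :: "nat \<Rightarrow> nat set set \<Rightarrow> (nat \<Rightarrow> real) set" where
  "ordered_cone N K = {q. (\<forall>k\<ge>N. q k = 0) \<and> (\<forall>k. q (Suc k) \<le> q k) \<and>
     (\<exists>s\<in>K. \<forall>k. k \<notin> s \<longrightarrow> q k = q (Suc k))}"

lemma ordered_cone_antimono:
  assumes "q \<in> ordered_cone N K" "i \<le> j"
  shows "q j \<le> q i"
proof (rule lift_Suc_antimono_le[OF _ assms(2)])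
  show "q (Suc k) \<le> q k" for k using assms(1) by (simp add: ordered_cone_def)
qed

lemma ordered_cone_bounds:
  assumes "q \<in> ordered_cone N K"
  shows "0 \<le> q k" "q k \<le> q 0"
proof -
  have "q (max k N) \<le> q k" by (rule ordered_cone_antimono[OF assms]) simp
  moreover have "q (max k N) = 0" using assms by (simp add: ordered_cone_def)
  ultimately show "0 \<le> q k" by simp
  show "q k \<le> q 0" by (rule ordered_cone_antimono[OF assms]) simp
qed

lemma ordered_cone_mono:
  assumes "q \<in> ordered_cone N K" "mono \<psi>" "\<psi> 0 = 0"
  shows "(\<lambda>k. \<psi> (q k)) \<in> ordered_cone N K"
proof -
  obtain s where "s \<in> K" "\<forall>k. k \<notin> s \<longrightarrow> q k = q (Suc k)"
    using assms(1) by (auto simp: ordered_cone_def)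
  then have "\<exists>s\<in>K. \<forall>k. k \<notin> s \<longrightarrow> \<psi> (q k) = \<psi> (q (Suc k))"
    by (intro bexI[of _ s]) auto
  then show ?thesis
    using assms by (simp add: ordered_cone_def monoD)
qed

lemma ordered_cone_scale:
  assumes "q \<in> ordered_cone N K" "0 \<le> c"
  shows "(\<lambda>k. c * q k) \<in> ordered_cone N K"
  by (rule ordered_cone_mono[OF assms(1)]) (auto intro: monoI mult_left_mono assms(2))

text \<open>
  The complex itself, as the slice of its cone at height 1.
\<close>

definition ordered_base :: "nat \<Rightarrow> nat set set \<Rightarrow> (nat \<Rightarrow> real) set" where
  "ordered_base N K = {q \<in> ordered_cone N K. q 0 = 1}"

lemma order_closed_ordered_base: "order_closed (ordered_base N K)"
  unfolding order_closed_def ordered_base_def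
proof (intro ballI allI impI CollectI)
  fix q and \<psi> :: "real \<Rightarrow> real" assume "q \<in> {q \<in> ordered_cone N K. q 0 = 1}" and \<psi>: "mono \<psi> \<and> \<psi> 0 = 0 \<and> \<psi> 1 = (1::real)"
  then have q: "q \<in> ordered_cone N K" "q 0 = 1" by auto
  have "(\<lambda>k. \<psi> (q k)) \<in> ordered_cone N K" using \<psi> by (intro ordered_cone_mono[OF q(1)]) auto
  then show "(\<lambda>k. \<psi> (q k)) \<in> ordered_cone N K \<and> \<psi> (q 0) = 1" using q(2) \<psi> by simp
qed

text \<open>
  The base must be nonempty because \<open>K\<close> may consist of the empty face alone: then the cone is its apex.
\<close>

lemma ordered_cone_eq_scale:
  assumes q: "q \<in> ordered_cone N K" and ne: "ordered_base N K \<noteq> {}"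
  shows "\<exists>p\<in>ordered_base N K. q = (\<lambda>k. q 0 * p k)"
proof (cases "q 0 = 0")
  case True
  then have "q k = 0" for k using ordered_cone_bounds[OF q, of k] by simp
  then have "q = (\<lambda>k. q 0 * p k)" for p by auto
  then show ?thesis using ne by blast
next
  case False
  then have pos: "q 0 > 0" using ordered_cone_bounds(1)[OF q, of 0] by simp
  have "(\<lambda>k. (1 / q 0) * q k) \<in> ordered_base N K"
    using ordered_cone_scale[OF q, of "1 / q 0"] pos by (simp add: ordered_base_def)
  then show ?thesis using pos by (intro bexI) auto
qed

text \<open>
  In barycentric coordinates a complex lies in the hyperplane where the coordinates sum to 1, which monotone
  coordinate changes do not preserve.  Tail sums turn this condition into \<open>q 0 = 1\<close> and nonnegativity into monotonicity.
\<close>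

definition tail_sums :: "nat \<Rightarrow> (nat \<Rightarrow> real) \<Rightarrow> nat \<Rightarrow> real" where
  "tail_sums N t k = (\<Sum>i\<in>{k..<N}. t i)"

lemma tail_sums_diff: "k < N \<Longrightarrow> tail_sums N t k - tail_sums N t (Suc k) = t k"
  by (simp add: tail_sums_def sum.atLeast_Suc_lessThan)

lemma inj_on_tail_sums:
  "inj_on (tail_sums N) {t. \<forall>i\<ge>N. t i = 0}"
proof (rule inj_onI, rule ext)
  fix t u k assume tu: "t \<in> {t. \<forall>i\<ge>N. t i = 0}" "u \<in> {t. \<forall>i\<ge>N. t i = 0}" "tail_sums N t = tail_sums N u"
  show "t k = u k"
  proof (cases "k < N")
    case True
    then show ?thesis using tail_sums_diff[of k N t] tail_sums_diff[of k N u] tu(3) by simp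
  next
    case False
    then show ?thesis using tu(1,2) by simp
  qed
qed

lemma tail_sums_image:
  assumes sub: "\<Union>K \<subseteq> {..<N}"
  shows "tail_sums N ` (\<Union>s\<in>K. face_simplex s) = ordered_base N K"
proof
  show "tail_sums N ` (\<Union>s\<in>K. face_simplex s) \<subseteq> ordered_base N K"
  proof clarify
    fix t s assume s: "s \<in> K" and t: "t \<in> face_simplex s"
    have sN: "s \<subseteq> {..<N}" using s sub by blast
    have "tail_sums N t 0 = (\<Sum>i\<in>s. t i)"
      unfolding tail_sums_def atLeast0LessThan
      using t by (intro sum.mono_neutral_right sN) (auto simp: face_simplex_def)
    then have "tail_sums N t 0 = 1" using t by (simp add: face_simplex_def)
    moreover have "tail_sums N t k = tail_sums N t (Suc k)" if "k \<notin> s" for k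
      using t tail_sums_diff[of k N t] that
      by (cases "k < N") (auto simp: face_simplex_def tail_sums_def)
    moreover have "tail_sums N t (Suc k) \<le> tail_sums N t k" for k
      using t tail_sums_diff[of k N t]
      by (cases "k < N") (auto simp: face_simplex_def tail_sums_def algebra_simps)
    moreover have "tail_sums N t k = 0" if "k \<ge> N" for k using that by (simp add: tail_sums_def)
    ultimately show "tail_sums N t \<in> ordered_base N K"
      using s by (auto simp: ordered_base_def ordered_cone_def)
  qed
  show "ordered_base N K \<subseteq> tail_sums N ` (\<Union>s\<in>K. face_simplex s)"
  proof
    fix q assume q: "q \<in> ordered_base N K"
    then obtain s where s: "s \<in> K" "\<And>k. k \<notin> s \<Longrightarrow> q k = q (Suc k)"
      by (auto simp: ordered_base_def ordered_cone_def)
    define t where "t = (\<lambda>k. q k - q (Suc k))"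
    have qN: "q k = 0" if "k \<ge> N" for k using q that by (simp add: ordered_base_def ordered_cone_def)
    have "tail_sums N t k = q k" for k
    proof (cases "k \<le> N")
      case True
      then show ?thesis
        using sum_Suc_diff'[of k N "\<lambda>k. - q k"] qN by (simp add: tail_sums_def t_def)
    qed (simp add: tail_sums_def qN)
    then have tq: "tail_sums N t = q" by auto
    have sN: "s \<subseteq> {..<N}" using s sub by blast
    have "(\<Sum>i\<in>s. t i) = tail_sums N t 0"
      unfolding tail_sums_def atLeast0LessThan
      using s(2) by (intro sum.mono_neutral_left sN) (auto simp: t_def)
    then have "(\<Sum>i\<in>s. t i) = 1" using tq q by (simp add: ordered_base_def)
    then have "t \<in> face_simplex s"
      using s(2) q by (auto simp: face_simplex_def t_def ordered_base_def ordered_cone_def)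
    then show "q \<in> tail_sums N ` (\<Union>s\<in>K. face_simplex s)" using s(1) tq by blast
  qed
qed

text \<open>
  The map \<open>U\<close> is the retraction onto the polyhedron, followed by the homeomorphism to a complex and by
  tail sums.  The description of the image of \<open>U\<close> is what cones and suspensions use.
\<close>

lemma cube_retraction_polyhedral:
  assumes adm: "admits_polyhedral_retractions X" and \<epsilon>: "0 < \<epsilon>"
  shows "\<exists>N K U R. cube_retraction (mtopology_of X) {..<N} U R \<and>
    U ` mspace X = ordered_base N K \<and> (\<forall>x\<in>mspace X. mdist X (R x) x < \<epsilon>)"
proof -
  let ?M = "mtopology_of X"
  obtain Y r where poly: "polyhedron_space (subtopology ?M Y)" and ret: "eps_retraction X \<epsilon> Y r"
    using adm \<epsilon> unfolding admits_polyhedral_retractions_def by blast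
  have YX: "Y \<subseteq> mspace X" and rc: "continuous_map ?M (subtopology ?M Y) r"
    and rY: "\<And>y. y \<in> Y \<Longrightarrow> r y = y"
    and sup: "(SUP x\<in>mspace X. ereal (mdist X (r x) x)) < ereal \<epsilon>"
    using ret by (auto simp: eps_retraction_def)
  have near: "mdist X (r x) x < \<epsilon>" if "x \<in> mspace X" for x
  proof -
    have "ereal (mdist X (r x) x) \<le> (SUP x\<in>mspace X. ereal (mdist X (r x) x))"
      using that by (rule SUP_upper)
    then show ?thesis using sup by (metis ereal_less_eq(3) le_less_trans less_ereal.simps(1))
  qed
  have topY: "topspace (subtopology ?M Y) = Y" using YX by auto
  have rcX: "continuous_map ?M ?M r" using rc by (simp add: continuous_map_in_subtopology)
  have rXY: "r x \<in> Y" if "x \<in> mspace X" for x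
    using rc that by (auto simp: continuous_map_in_subtopology)
  obtain K where K: "finite_simplicial_complex K" and
    hom: "subtopology ?M Y homeomorphic_space subtopology (powertop_real UNIV) (\<Union>s\<in>K. face_simplex s)"
    using poly by (auto simp: polyhedron_space_def)
  let ?S = "\<Union>s\<in>K. face_simplex s"
  obtain h where h: "homeomorphic_map (subtopology ?M Y) (subtopology (powertop_real UNIV) ?S) h"
    using hom by (auto simp: homeomorphic_space)
  have hY: "h ` Y = ?S" and hinj: "inj_on h Y"
    and hc: "continuous_map (subtopology ?M Y) (powertop_real UNIV) h"
    using h topY by (auto simp: homeomorphic_eq_everything_map continuous_map_in_subtopology)
  have "finite (\<Union>K)" using K by (auto simp: finite_simplicial_complex_def)
  then obtain N where N: "\<Union>K \<subseteq> {..<N}" using finite_nat_bounded by blast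
  define U where "U = (\<lambda>x. tail_sums N (h (r x)))"
  have rX: "r ` mspace X = Y" using rXY rY YX by force
  have img: "U ` mspace X = ordered_base N K"
    using tail_sums_image[OF N] by (simp add: U_def hY[symmetric] rX[symmetric] image_image)
  have Ubase: "U x \<in> ordered_cone N K" "U x 0 = 1" if "x \<in> mspace X" for x
    using img that by (auto simp: ordered_base_def)
  have "continuous_map ?M (powertop_real UNIV) (\<lambda>x. h (r x))"
    using continuous_map_compose[OF rc hc] by (simp add: o_def)
  then have "continuous_map ?M euclideanreal (\<lambda>x. h (r x) i)" for i
    by (simp add: continuous_map_componentwise_UNIV)
  then have Uc: "continuous_map ?M euclideanreal (\<lambda>x. U x k)" for k
    unfolding U_def tail_sums_def by (intro continuous_map_sum) auto
  have S0: "?S \<subseteq> {t. \<forall>i\<ge>N. t i = 0}"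
  proof
    fix t assume "t \<in> ?S"
    then obtain s where s: "s \<in> K" "t \<in> face_simplex s" by blast
    have "t i = 0" if "i \<ge> N" for i
    proof -
      have "i \<notin> s" using s(1) N that by force
      then show ?thesis using s(2) by (simp add: face_simplex_def)
    qed
    then show "t \<in> {t. \<forall>i\<ge>N. t i = 0}" by simp
  qed
  have kernel: "r x = r y" if "x \<in> mspace X" "y \<in> mspace X" "U x = U y" for x y
  proof -
    have "h (r x) \<in> ?S" "h (r y) \<in> ?S" using rXY that hY by blast+
    then have "h (r x) = h (r y)"
      using inj_on_tail_sums[of N] that(3) S0 unfolding U_def by (meson inj_onD subsetD)
    then show ?thesis using hinj rXY that by (meson inj_onD)
  qed
  have "cube_retraction ?M {..<N} U r"
    unfolding cube_retraction_def
  proof (intro conjI ballI allI impI)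
    show "order_closed (U ` topspace ?M)" using img order_closed_ordered_base by simp
    fix x assume "x \<in> topspace ?M"
    then have x: "x \<in> mspace X" by simp
    show "U (r x) = U x" using rY[OF rXY[OF x]] by (simp add: U_def)
    show "0 \<le> U x k" "U x k \<le> 1" for k
      using ordered_cone_bounds[OF Ubase(1)[OF x], of k] Ubase(2)[OF x] by auto
    show "U x k = 0" if "k \<notin> {..<N}" for k using that by (simp add: U_def tail_sums_def)
    fix y assume "y \<in> topspace ?M" and eq: "U x = U y"
    then have y: "y \<in> mspace X" by simp
    show "r x = r y" by (rule kernel[OF x y eq])
  next
    show "continuous_map ?M ?M r" by (rule rcX)
    show "continuous_map ?M euclideanreal (\<lambda>x. U x k)" for k by (rule Uc)
  qed simp
  moreover have "\<forall>x\<in>mspace X. mdist X (r x) x < \<epsilon>" using near by simp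
  ultimately show ?thesis using img
    by (intro exI[of _ N] exI[of _ K] exI[of _ U] exI[of _ r]) simp
qed

section \<open>Cones and suspensions\<close>

text \<open>
  Coordinates of the cone and of the suspension over a polyhedron, for heights \<open>s\<close> between -1 and 1.  The base
  shrinks by the factor \<open>1 - \<bar>s\<bar>\<close>, which is also the first of its scaled coordinates.  The additional
  coordinate is 1 on the upper half and equals \<open>1 - \<bar>s\<bar>\<close> on the lower half, so both
  halves are described by comparisons.
\<close>

definition cylinder_coords :: "('a \<Rightarrow> nat \<Rightarrow> real) \<Rightarrow> 'a \<times> real \<Rightarrow> nat \<Rightarrow> real" where
  "cylinder_coords U p = case_nat (min 1 (1 + snd p)) (\<lambda>k. (1 - \<bar>snd p\<bar>) * U (fst p) k)"

lemma cylinder_coords_simps [simp]: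
  "cylinder_coords U p 0 = min 1 (1 + snd p)"
  "cylinder_coords U p (Suc k) = (1 - \<bar>snd p\<bar>) * U (fst p) k"
  by (simp_all add: cylinder_coords_def)

lemma cylinder_coords_eqD:
  assumes eq: "cylinder_coords U p = cylinder_coords U p'"
    and s: "\<bar>snd p\<bar> \<le> 1" "\<bar>snd p'\<bar> \<le> 1" and U0: "U (fst p) 0 = 1" "U (fst p') 0 = 1"
  shows "snd p = snd p'" "\<bar>snd p\<bar> \<noteq> 1 \<Longrightarrow> U (fst p) = U (fst p')"
proof -
  have "cylinder_coords U p 0 = cylinder_coords U p' 0" "cylinder_coords U p (Suc 0) = cylinder_coords U p' (Suc 0)"
    by (simp_all only: eq)
  then have "min 1 (1 + snd p) = min 1 (1 + snd p')" "\<bar>snd p\<bar> = \<bar>snd p'\<bar>"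
    using U0 by simp_all
  then show s_eq: "snd p = snd p'" by (auto simp: min_def abs_if split: if_splits)
  assume n1: "\<bar>snd p\<bar> \<noteq> 1"
  have "U (fst p) k = U (fst p') k" for k
    using fun_cong[OF eq, of "Suc k"] n1 s_eq by simp
  then show "U (fst p) = U (fst p')" by blast
qed

text \<open>
  A monotone \<open>\<psi>\<close> maps the scaled base point to another point of \<open>ordered_cone N K\<close>, whose height
  \<open>q 0\<close> determines the new height \<open>s'\<close> in the same half of the cylinder.
\<close>

lemma order_closed_cylinder_coords:
  assumes U: "U ` A = ordered_base N K" and S: "S = {0..1} \<or> S = {-1..1}"
  shows "order_closed (cylinder_coords U ` (A \<times> S))"
  unfolding order_closed_def
proof (intro ballI allI impI)
  fix y and \<psi> :: "real \<Rightarrow> real"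
  assume "y \<in> cylinder_coords U ` (A \<times> S)" and \<psi>: "mono \<psi> \<and> \<psi> 0 = 0 \<and> \<psi> 1 = 1"
  then obtain x s where y: "y = cylinder_coords U (x, s)" and x: "x \<in> A" and s: "s \<in> S" by auto
  have s1: "\<bar>s\<bar> \<le> 1" using S s by auto
  have Ux: "U x \<in> ordered_cone N K" "U x 0 = 1" using U x by (auto simp: ordered_base_def)
  define q where "q = (\<lambda>k. \<psi> ((1 - \<bar>s\<bar>) * U x k))"
  have "(\<lambda>k. (1 - \<bar>s\<bar>) * U x k) \<in> ordered_cone N K"
    using s1 by (intro ordered_cone_scale Ux) auto
  then have q: "q \<in> ordered_cone N K"
    using ordered_cone_mono[of _ N K \<psi>] \<psi> unfolding q_def by blast
  have "ordered_base N K \<noteq> {}" using U x by blast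
  then obtain p where "p \<in> ordered_base N K" and qp: "q = (\<lambda>k. q 0 * p k)"
    using ordered_cone_eq_scale[OF q] by blast
  then have "p \<in> U ` A" using U by simp
  then obtain x' where x': "x' \<in> A" "U x' = p" by auto
  have q0: "q 0 = \<psi> (1 - \<bar>s\<bar>)" using Ux(2) by (simp add: q_def)
  have "\<psi> 0 \<le> \<psi> (1 - \<bar>s\<bar>)" by (rule monoD[of \<psi>]) (use \<psi> s1 in auto)
  moreover have "\<psi> (1 - \<bar>s\<bar>) \<le> \<psi> 1" by (rule monoD[of \<psi>]) (use \<psi> s1 in auto)
  ultimately have q01: "0 \<le> q 0" "q 0 \<le> 1" using \<psi> q0 by auto
  define s' where "s' = (if 0 \<le> s then 1 - q 0 else q 0 - 1)"
  have s'S: "s' \<in> S" using S s q01 by (auto simp: s'_def)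
  have abs: "1 - \<bar>s'\<bar> = q 0" using q01 by (auto simp: s'_def)
  have "\<psi> (y v) = cylinder_coords U (x', s') v" for v
  proof (cases v)
    case 0
    then show ?thesis using \<psi> q0 q01 by (auto simp: y s'_def min_def)
  next
    case (Suc k)
    then show ?thesis using fun_cong[OF qp, of k] abs x'(2) by (simp add: y q_def)
  qed
  then have "(\<lambda>v. \<psi> (y v)) = cylinder_coords U (x', s')" by blast
  then show "(\<lambda>v. \<psi> (y v)) \<in> cylinder_coords U ` (A \<times> S)" using x'(1) s'S by blast
qed

text \<open>
  The cone and the suspension are both obtained from a cylinder by identifying points at equal height \<open>s\<close>
  with \<open>\<bar>s\<bar> = 1\<close>.  A retraction \<open>R\<close> of the base that moves points little induces the retraction
  \<open>(x, s) \<mapsto> (R x, s)\<close> of the quotient.  It moves points little in every compatible metric \<open>D\<close>, because the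
  distance in \<open>D\<close> between the classes of \<open>(x, s)\<close> and \<open>(x', s)\<close> is a continuous function on a compact space
  that vanishes for \<open>x = x'\<close>.
\<close>

lemma zero_CR_space_collapsed_cylinder:
  fixes X :: "'a metric" and T :: "'b topology"
  assumes comp: "compact_space (mtopology_of X)" and adm: "admits_polyhedral_retractions X"
    and S: "S = {0..1} \<or> S = {-1..1::real}"
    and q: "quotient_map (prod_topology (mtopology_of X) (top_of_set S)) T q"
    and q_eq: "\<And>p p'. p \<in> mspace X \<times> S \<Longrightarrow> p' \<in> mspace X \<times> S \<Longrightarrow>
      q p = q p' \<longleftrightarrow> snd p = snd p' \<and> (fst p = fst p' \<or> \<bar>snd p\<bar> = 1)"
  shows "zero_CR_space T"
proof -
  let ?M = "mtopology_of X" and ?C = "prod_topology (mtopology_of X) (top_of_set S)"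
  have topC: "topspace ?C = mspace X \<times> S" by simp
  have Sabs: "\<bar>s\<bar> \<le> 1" if "s \<in> S" for s using S that by auto
  have "compact S" using S by auto
  then have compC: "compact_space ?C"
    using comp by (simp add: compact_space_prod_topology compact_space_subtopology compactin_euclidean_iff)
  have compT: "compact_space T" by (rule compact_space_quotient_image[OF q compC])
  have qc: "continuous_map ?C T q" and qim: "q ` (mspace X \<times> S) = topspace T"
    using q quotient_imp_continuous_map quotient_imp_surjective_map topC by (blast, metis)
  have cfst: "continuous_map ?C ?M fst" by (rule continuous_map_fst)
  have csnd: "continuous_map ?C euclideanreal snd"
    using continuous_map_snd[of ?M "top_of_set S"] by (simp add: continuous_map_in_subtopology)
  have models: "\<exists>N K U R. cube_retraction ?M {..<N} U R \<and> U ` mspace X = ordered_base N K \<and>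
      (\<forall>x\<in>mspace X. mdist X (R x) x < 1 / real (Suc n))" for n
    by (rule cube_retraction_polyhedral[OF adm]) simp
  \<comment> \<open>The functions \<open>(x, s) \<mapsto> s\<close> and \<open>(x, s) \<mapsto> (1 - \<bar>s\<bar>) * U n x k\<close> respect the identification.  They separate
     the classes since \<open>R n\<close>, which is determined by \<open>U n\<close>, converges to the identity.\<close>
  have met: "metrizable_space T"
  proof -
    obtain N :: "nat \<Rightarrow> nat" and U R where cr: "\<And>n. cube_retraction ?M {..<N n} (U n) (R n)"
      and near: "\<And>n x. x \<in> mspace X \<Longrightarrow> mdist X (R n x) x < 1 / real (Suc n)"
    proof -
      have "\<exists>m :: nat \<times> _ \<times> _. cube_retraction ?M {..<fst m} (fst (snd m)) (snd (snd m)) \<and>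
          (\<forall>x\<in>mspace X. mdist X (snd (snd m) x) x < 1 / real (Suc n))" for n
      proof -
        obtain N :: nat and K U R where "cube_retraction ?M {..<N} U R \<and> U ` mspace X = ordered_base N K \<and>
            (\<forall>x\<in>mspace X. mdist X (R x) x < 1 / real (Suc n))"
          using models[of n] by (elim exE)
        then show ?thesis by (intro exI[of _ "(N, U, R)"]) simp
      qed
      then have "\<exists>m :: nat \<Rightarrow> nat \<times> _ \<times> _. \<forall>n. cube_retraction ?M {..<fst (m n)} (fst (snd (m n))) (snd (snd (m n))) \<and>
          (\<forall>x\<in>mspace X. mdist X (snd (snd (m n)) x) x < 1 / real (Suc n))"
        by (intro choice allI)
      then obtain m :: "nat \<Rightarrow> nat \<times> _ \<times> _" where
        m: "\<forall>n. cube_retraction ?M {..<fst (m n)} (fst (snd (m n))) (snd (snd (m n))) \<and>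
          (\<forall>x\<in>mspace X. mdist X (snd (snd (m n)) x) x < 1 / real (Suc n))"
        by (elim exE)
      show thesis
        by (rule that[of "\<lambda>n. fst (m n)" "\<lambda>n. fst (snd (m n))" "\<lambda>n. snd (snd (m n))"]) (use m in auto)
    qed
    define F where "F = (\<lambda>p (n, k). case n of 0 \<Rightarrow> snd p | Suc n \<Rightarrow> (1 - \<bar>snd p\<bar>) * U n (fst p) k)"
    have Fc: "continuous_map ?C euclideanreal (\<lambda>p. F p nk)" for nk
    proof (cases nk)
      case (Pair n k)
      show ?thesis
      proof (cases n)
        case 0
        then show ?thesis using csnd Pair by (simp add: F_def)
      next
        case (Suc n')
        have "continuous_map ?C euclideanreal (\<lambda>p. U n' (fst p) k)"
          using continuous_map_compose[OF cfst cube_retractionD(2)[OF cr]] by (simp add: o_def)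
        then show ?thesis using Suc Pair csnd
          by (simp add: F_def) (intro continuous_intros; simp)
      qed
    qed
    have F_eq: "F p = F p' \<longleftrightarrow> q p = q p'" if p: "p \<in> mspace X \<times> S" "p' \<in> mspace X \<times> S" for p p'
    proof
      assume eq: "F p = F p'"
      have s: "snd p = snd p'" using fun_cong[OF eq, of "(0, 0)"] by (simp add: F_def)
      have m: "fst p \<in> mspace X" "fst p' \<in> mspace X" using p by auto
      have "fst p = fst p'" if n1: "\<bar>snd p\<bar> \<noteq> 1"
      proof -
        have "U n (fst p) k = U n (fst p') k" for n k
          using fun_cong[OF eq, of "(Suc n, k)"] n1 s by (simp add: F_def)
        then have U_eq: "U n (fst p) = U n (fst p')" for n by blast
        have R: "R n (fst p) = R n (fst p')" for n
          by (rule cube_retractionD(7)[OF cr _ _ U_eq]) (simp_all add: m)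
        have "mdist X (fst p) (fst p') \<le> 0"
        proof (rule ccontr)
          assume "\<not> ?thesis"
          then obtain n where n: "1 / real (Suc n) < mdist X (fst p) (fst p') / 2"
            using nat_approx_posE[of "mdist X (fst p) (fst p') / 2"] by auto
          have "R n (fst p) \<in> mspace X" using cube_retractionD(10)[OF cr] m by simp
          then have "mdist X (fst p) (fst p') \<le> mdist X (R n (fst p)) (fst p) + mdist X (R n (fst p')) (fst p')"
            using mdist_triangle[of "fst p" X "R n (fst p)" "fst p'"] m R[of n] mdist_commute[of X "fst p"] by auto
          then show False using near[OF m(1), of n] near[OF m(2), of n] n by linarith
        qed
        then have "mdist X (fst p) (fst p') = 0" by (simp add: order_antisym)
        then show ?thesis using m by simp
      qed
      then show "q p = q p'" using q_eq[OF p] s by blast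
    next
      assume "q p = q p'"
      then have *: "snd p = snd p'" "fst p = fst p' \<or> \<bar>snd p\<bar> = 1" using q_eq[OF p] by auto
      show "F p = F p'"
      proof
        fix nk show "F p nk = F p' nk"
          using * by (cases nk) (auto simp: F_def split: nat.split)
      qed
    qed
    have "continuous_map ?C (powertop_real UNIV) F"
      using Fc by (simp add: continuous_map_componentwise_UNIV)
    then have "\<exists>G. continuous_map T (powertop_real UNIV) G \<and> (\<forall>p\<in>topspace ?C. G (q p) = F p)"
      by (rule quotient_map_factor[OF q]) (simp add: F_eq)
    then obtain G where G: "continuous_map T (powertop_real UNIV) G" "\<forall>p\<in>topspace ?C. G (q p) = F p"
      by (elim exE conjE)
    show ?thesis
    proof (rule metrizable_of_separating_family[OF compT])
      show "continuous_map T euclideanreal (\<lambda>z. G z k)" for k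
        using G(1) unfolding continuous_map_componentwise_UNIV by (rule spec)
      show "inj_on G (topspace T)"
      proof (rule inj_onI)
        fix z z' assume "z \<in> topspace T" "z' \<in> topspace T" and eq: "G z = G z'"
        then obtain p p' where p: "p \<in> mspace X \<times> S" "z = q p" and p': "p' \<in> mspace X \<times> S" "z' = q p'"
          unfolding qim[symmetric] by blast
        have "G (q p) = F p" "G (q p') = F p'" using bspec[OF G(2)] p(1) p'(1) topC by auto
        then have "F p = F p'" using eq p(2) p'(2) by simp
        then show "z = z'" using F_eq[OF p(1) p'(1)] p(2) p'(2) by simp
      qed
    qed
  qed
  have "D \<in> zero_CR" if D: "mtopology_of D = T" for D
  proof (rule zero_CR_of_cube_retractions)
    show "compact_space (mtopology_of D)" using compT D by simp
    fix \<epsilon> :: real assume \<epsilon>: "0 < \<epsilon>"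
    have "\<exists>\<delta>>0. \<forall>z\<in>topspace (prod_topology ?M ?C). mdist X (fst z) (fst (snd z)) < \<delta> \<longrightarrow>
        mdist D (q (fst z, snd (snd z))) (q (snd z)) < \<epsilon>"
    proof (rule compact_space_uniformly_small)
      show "compact_space (prod_topology ?M ?C)" using comp compC by (simp add: compact_space_prod_topology)
      have c1: "continuous_map (prod_topology ?M ?C) ?M fst" by (rule continuous_map_fst)
      have c2: "continuous_map (prod_topology ?M ?C) ?C snd" by (rule continuous_map_snd)
      have c3: "continuous_map (prod_topology ?M ?C) ?M (\<lambda>z. fst (snd z))"
        using continuous_map_compose[OF c2 continuous_map_fst] by (simp add: o_def)
      have c4: "continuous_map (prod_topology ?M ?C) (top_of_set S) (\<lambda>z. snd (snd z))"
        using continuous_map_compose[OF c2 continuous_map_snd] by (simp add: o_def)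
      show "continuous_map (prod_topology ?M ?C) euclideanreal (\<lambda>z. mdist X (fst z) (fst (snd z)))"
        by (intro continuous_map_mdist c1 c3)
      have c5: "continuous_map (prod_topology ?M ?C) ?C (\<lambda>z. (fst z, snd (snd z)))"
        by (intro continuous_map_pairedI c1 c4)
      show "continuous_map (prod_topology ?M ?C) euclideanreal (\<lambda>z. mdist D (q (fst z, snd (snd z))) (q (snd z)))"
        using continuous_map_compose[OF c5 qc] continuous_map_compose[OF c2 qc] D
        by (intro continuous_map_mdist) (simp_all add: o_def)
      fix z assume z: "z \<in> topspace (prod_topology ?M ?C)" "mdist X (fst z) (fst (snd z)) \<le> 0"
      then have "mdist X (fst z) (fst (snd z)) = 0" by (simp add: order_antisym)
      then have "fst z = fst (snd z)" using z(1) by auto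
      then have "(fst z, snd (snd z)) = snd z" by simp
      moreover have "q (snd z) \<in> mspace D" using z(1) qim D by (auto simp flip: topspace_mtopology_of)
      ultimately show "mdist D (q (fst z, snd (snd z))) (q (snd z)) < \<epsilon>" using \<epsilon> by (simp add: mdist_self)
    qed
    then obtain \<delta> where \<delta>: "0 < \<delta>" "\<And>z. z \<in> topspace (prod_topology ?M ?C) \<Longrightarrow>
        mdist X (fst z) (fst (snd z)) < \<delta> \<Longrightarrow> mdist D (q (fst z, snd (snd z))) (q (snd z)) < \<epsilon>"
      by blast
    obtain N K U R where cr: "cube_retraction ?M {..<N} U R" and img: "U ` mspace X = ordered_base N K"
      and near: "\<forall>x\<in>mspace X. mdist X (R x) x < \<delta>"
      using cube_retraction_polyhedral[OF adm \<delta>(1)] by (elim exE conjE)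
    note U = cube_retractionD[OF cr, simplified]
    have U0: "U x 0 = 1" if "x \<in> mspace X" for x
      using img that by (auto simp: ordered_base_def)
    let ?W = "cylinder_coords U"
    define Q where "Q = (\<lambda>p. q (R (fst p), snd p))"
    have Wc: "continuous_map ?C euclideanreal (\<lambda>p. ?W p v)" for v
    proof (cases v)
      case 0
      then show ?thesis using csnd by simp (intro continuous_intros; simp)
    next
      case (Suc k)
      have "continuous_map ?C euclideanreal (\<lambda>p. U (fst p) k)"
        using continuous_map_compose[OF cfst U(2)] by (simp add: o_def)
      then show ?thesis using csnd Suc by simp (intro continuous_intros; simp)
    qed
    then have Wc': "continuous_map ?C (powertop_real UNIV) ?W"
      by (simp add: continuous_map_componentwise_UNIV)
    have Qc: "continuous_map ?C T Q"
    proof -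
      have "continuous_map ?C ?M (\<lambda>p. R (fst p))"
        using continuous_map_compose[OF cfst U(3)] by (simp add: o_def)
      then have "continuous_map ?C ?C (\<lambda>p. (R (fst p), snd p))"
        by (intro continuous_map_pairedI continuous_map_snd)
      then show ?thesis using continuous_map_compose[OF _ qc] by (auto simp: o_def Q_def)
    qed
    have W_fact: "?W p = ?W p'" if "p \<in> topspace ?C" "p' \<in> topspace ?C" "q p = q p'" for p p'
    proof -
      have *: "snd p = snd p'" "fst p = fst p' \<or> \<bar>snd p\<bar> = 1" using q_eq[of p p'] that topC by auto
      then show ?thesis by (auto simp: cylinder_coords_def)
    qed
    have Q_fact: "Q p = Q p'" if "p \<in> topspace ?C" "p' \<in> topspace ?C" "q p = q p'" for p p'
    proof -
      have *: "snd p = snd p'" "fst p = fst p' \<or> \<bar>snd p\<bar> = 1" using q_eq[of p p'] that topC by auto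
      then show ?thesis
        unfolding Q_def using q_eq[of "(R (fst p), snd p)" "(R (fst p'), snd p')"] that U(10) by auto
    qed
    have "\<exists>U'. continuous_map T (powertop_real UNIV) U' \<and> (\<forall>p\<in>topspace ?C. U' (q p) = ?W p)"
      by (rule quotient_map_factor[OF q Wc' W_fact])
    then obtain U' where U'1: "continuous_map T (powertop_real UNIV) U'" and "\<forall>p\<in>topspace ?C. U' (q p) = ?W p"
      by (elim exE conjE)
    then have U'2: "U' (q p) = ?W p" if "p \<in> topspace ?C" for p using that by blast
    note U' = U'1 U'2
    have "\<exists>R'. continuous_map T T R' \<and> (\<forall>p\<in>topspace ?C. R' (q p) = Q p)"
      by (rule quotient_map_factor[OF q Qc Q_fact])
    then obtain R' where R'1: "continuous_map T T R'" and "\<forall>p\<in>topspace ?C. R' (q p) = Q p"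
      by (elim exE conjE)
    then have R'2: "R' (q p) = Q p" if "p \<in> topspace ?C" for p using that by blast
    note R' = R'1 R'2
    have rep: "\<exists>p\<in>mspace X \<times> S. z = q p" if "z \<in> topspace T" for z using qim that by blast
    have "cube_retraction T {..<Suc N} U' R'"
      unfolding cube_retraction_def
    proof (intro conjI ballI allI impI)
      show "continuous_map T euclideanreal (\<lambda>z. U' z v)" for v
        using U'(1) by (simp add: continuous_map_componentwise_UNIV)
      show "continuous_map T T R'" by (rule R'(1))
      have "U' ` topspace T = ?W ` (mspace X \<times> S)"
        unfolding qim[symmetric] image_image using U'(2) topC by (intro image_cong) auto
      then show "order_closed (U' ` topspace T)"
        using order_closed_cylinder_coords[OF img S] by simp
      fix z assume z: "z \<in> topspace T"
      obtain p where p: "p \<in> mspace X \<times> S" "z = q p" using rep[OF z] by blast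
      have Uz: "U' z = ?W p" and Rz: "R' z = Q p" using U'(2) R'(2) p by auto
      have m: "fst p \<in> mspace X" "snd p \<in> S" "\<bar>snd p\<bar> \<le> 1" using p Sabs by auto
      have Rm: "R (fst p) \<in> mspace X" using U(10) m by simp
      have "0 \<le> ?W p v \<and> ?W p v \<le> 1 \<and> (v \<notin> {..<Suc N} \<longrightarrow> ?W p v = 0)" for v
      proof (cases v)
        case 0
        then show ?thesis using m(3) by auto
      next
        case (Suc k)
        then show ?thesis
          using m(3) U(4)[OF m(1), of k] U(5)[OF m(1), of k] U(6)[OF m(1), of k] by (auto intro: mult_le_one)
      qed
      then show "0 \<le> U' z v" "U' z v \<le> 1" "v \<notin> {..<Suc N} \<Longrightarrow> U' z v = 0" for v
        unfolding Uz by auto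
      show "U' (R' z) = U' z"
      proof -
        have "U' (R' z) = ?W (R (fst p), snd p)"
          unfolding Rz Q_def using Rm m by (intro U'(2)) auto
        also have "\<dots> = ?W p" using U(8)[OF m(1)] by (simp add: cylinder_coords_def)
        finally show ?thesis using Uz by simp
      qed
      fix z' assume z': "z' \<in> topspace T" and eq: "U' z = U' z'"
      obtain p' where p': "p' \<in> mspace X \<times> S" "z' = q p'" using rep[OF z'] by blast
      have m': "fst p' \<in> mspace X" "snd p' \<in> S" "\<bar>snd p'\<bar> \<le> 1" using p' Sabs by auto
      have W_eq: "?W p = ?W p'" using eq Uz U'(2)[of p'] p' by simp
      note s_eq = cylinder_coords_eqD(1)[OF W_eq m(3) m'(3) U0[OF m(1)] U0[OF m'(1)]]
      note U_eq = cylinder_coords_eqD(2)[OF W_eq m(3) m'(3) U0[OF m(1)] U0[OF m'(1)]]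
      have "Q p = Q p'"
      proof (cases "\<bar>snd p\<bar> = 1")
        case True
        then show ?thesis
          unfolding Q_def using q_eq[of "(R (fst p), snd p)" "(R (fst p'), snd p')"] m m' U(10) s_eq by auto
      next
        case False
        then have "R (fst p) = R (fst p')" using U(7)[OF m(1) m'(1)] U_eq by blast
        then show ?thesis by (simp add: Q_def s_eq)
      qed
      then show "R' z = R' z'" using Rz R'(2)[of p'] p' by simp
    qed simp
    moreover have "mdist D (R' z) z < \<epsilon>" if "z \<in> mspace D" for z
    proof -
      have "z \<in> topspace T" using that D by (simp flip: topspace_mtopology_of)
      then obtain p where p: "p \<in> mspace X \<times> S" "z = q p" using rep by blast
      have "mdist D (q (R (fst p), snd p)) (q p) < \<epsilon>"
        using \<delta>(2)[of "(R (fst p), p)"] p near U(10) by auto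
      then show ?thesis using R'(2)[of p] p by (simp add: Q_def)
    qed
    ultimately show "\<exists>(V::nat set) U R. cube_retraction (mtopology_of D) V U R \<and> (\<forall>x\<in>mspace D. mdist D (R x) x < \<epsilon>)"
      unfolding D by blast
  qed
  then show ?thesis using met by (simp add: zero_CR_space_def)
qed

lemma zero_CR_space_cone:
  assumes "compact_space (mtopology_of X)" "admits_polyhedral_retractions X"
  shows "zero_CR_space (cone_topology (mtopology_of X))"
proof (rule zero_CR_space_collapsed_cylinder[OF assms])
  let ?C = "prod_topology (mtopology_of X) (top_of_set {0..1::real})"
  let ?r = "collapse_rel (topspace ?C) {mspace X \<times> {1}}"
  show "{0..1::real} = {0..1} \<or> {0..1::real} = {-1..1}" by simp
  have eqv: "equiv (topspace ?C) ?r" by (rule equiv_collapse_rel) auto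
  show "quotient_map ?C (cone_topology (mtopology_of X)) (\<lambda>p. ?r `` {p})"
    using quotient_map_quotient_topology[OF eqv]
    by (simp add: cone_topology_def collapse_topology_def)
  fix p p' :: "'a \<times> real"
  assume "p \<in> mspace X \<times> {0..1}" "p' \<in> mspace X \<times> {0..1}"
  then show "?r `` {p} = ?r `` {p'} \<longleftrightarrow> snd p = snd p' \<and> (fst p = fst p' \<or> \<bar>snd p\<bar> = 1)"
    by (subst eq_equiv_class_iff[OF eqv]) (auto simp: collapse_rel_def)
qed

lemma zero_CR_space_suspension:
  assumes "compact_space (mtopology_of X)" "admits_polyhedral_retractions X"
  shows "zero_CR_space (suspension_topology (mtopology_of X))"
proof (rule zero_CR_space_collapsed_cylinder[OF assms])
  let ?C = "prod_topology (mtopology_of X) (top_of_set {-1..1::real})"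
  let ?r = "collapse_rel (topspace ?C) {mspace X \<times> {1}, mspace X \<times> {-1}}"
  show "{-1..1::real} = {0..1} \<or> {-1..1::real} = {-1..1}" by simp
  have eqv: "equiv (topspace ?C) ?r" by (rule equiv_collapse_rel) auto
  show "quotient_map ?C (suspension_topology (mtopology_of X)) (\<lambda>p. ?r `` {p})"
    using quotient_map_quotient_topology[OF eqv]
    by (simp add: suspension_topology_def collapse_topology_def)
  fix p p' :: "'a \<times> real"
  assume "p \<in> mspace X \<times> {-1..1}" "p' \<in> mspace X \<times> {-1..1}"
  then show "?r `` {p} = ?r `` {p'} \<longleftrightarrow> snd p = snd p' \<and> (fst p = fst p' \<or> \<bar>snd p\<bar> = 1)"
    by (subst eq_equiv_class_iff[OF eqv]) (auto simp: collapse_rel_def abs_if split: if_splits)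
qed

section \<open>Countable products\<close>

text \<open>
  A compatible metric \<open>D\<close> on the product is controlled up to \<open>\<epsilon>\<close> by finitely many coordinates \<open>J\<close>.
  Retract these factors onto polyhedra and collapse all others to a base point \<open>e\<close>; the
  image is a copy of the product of the polyhedra for \<open>J\<close>.
\<close>

lemma zero_CR_space_product:
  fixes X :: "'i \<Rightarrow> 'a metric"
  assumes I: "countable I" and comp: "\<And>i. i \<in> I \<Longrightarrow> compact_space (mtopology_of (X i))"
    and adm: "\<And>i. i \<in> I \<Longrightarrow> admits_polyhedral_retractions (X i)"
  shows "zero_CR_space (product_topology (\<lambda>i. mtopology_of (X i)) I)"
proof -
  let ?T = "product_topology (\<lambda>i. mtopology_of (X i)) I"
  have compT: "compact_space ?T" using comp by (simp add: compact_space_product_topology)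
  have topT: "topspace ?T = (\<Pi>\<^sub>E i\<in>I. mspace (X i))" by simp
  have "metrizable_space (mtopology_of (X i))" for i
    using Metric_space.metrizable_space_mtopology[OF Metric_space_mspace_mdist] by (simp add: mtopology_of_def)
  moreover have "countable {i \<in> I. \<not> (\<exists>a. topspace (mtopology_of (X i)) \<subseteq> {a})}"
    by (rule countable_subset[OF _ I]) auto
  ultimately have met: "metrizable_space ?T"
    by (simp add: metrizable_space_product_topology)
  have proj: "continuous_map ?T (mtopology_of (X i)) (\<lambda>x. x i)" if "i \<in> I" for i
    using that by (rule continuous_map_product_projection)
  have "D \<in> zero_CR" if D: "mtopology_of D = ?T" for D
  proof (rule zero_CR_of_cube_retractions)
    show "compact_space (mtopology_of D)" using compT D by simp
    fix \<epsilon> :: real assume \<epsilon>: "0 < \<epsilon>"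
    show "\<exists>(V::('i \<times> nat) set) U R. cube_retraction (mtopology_of D) V U R \<and> (\<forall>x\<in>mspace D. mdist D (R x) x < \<epsilon>)"
    proof (cases "topspace ?T = {}")
      case True
      have "order_closed ((\<lambda>_ _. 0 :: real) ` topspace ?T)" unfolding True by (simp add: order_closed_def)
      then have "cube_retraction ?T {} (\<lambda>_ (_::'i \<times> nat). 0) (\<lambda>x. x)"
        using True by (simp add: cube_retraction_def)
      moreover have "mspace D = {}" using True D by (metis topspace_mtopology_of)
      ultimately show ?thesis unfolding D by blast
    next
      case False
      then obtain e where e: "e \<in> topspace ?T" by blast
      have "\<exists>J \<sigma>. finite J \<and> J \<subseteq> I \<and> 0 < \<sigma> \<and> (\<forall>z\<in>topspace (prod_topology ?T ?T).
          (\<forall>i\<in>J. mdist (X i) (fst z i) (snd z i) < \<sigma>) \<longrightarrow> mdist D (fst z) (snd z) < \<epsilon>)"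
      proof (rule compact_space_uniform_bound)
        show "compact_space (prod_topology ?T ?T)" using compT by (simp add: compact_space_prod_topology)
        show "continuous_map (prod_topology ?T ?T) euclideanreal (\<lambda>z. mdist (X i) (fst z i) (snd z i))"
          if "i \<in> I" for i
          using continuous_map_compose[OF continuous_map_fst proj[OF that]]
            continuous_map_compose[OF continuous_map_snd proj[OF that]]
          by (intro continuous_map_mdist) (simp_all add: o_def)
        show "continuous_map (prod_topology ?T ?T) euclideanreal (\<lambda>z. mdist D (fst z) (snd z))"
          by (intro continuous_map_mdist) (simp_all add: D continuous_map_fst continuous_map_snd)
        fix z assume z: "z \<in> topspace (prod_topology ?T ?T)"
          and eq: "\<And>i. i \<in> I \<Longrightarrow> mdist (X i) (fst z i) (snd z i) \<le> 0"
        have m: "fst z \<in> topspace ?T" "snd z \<in> topspace ?T" using z by auto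
        have "fst z i = snd z i" if i: "i \<in> I" for i
        proof -
          have "mdist (X i) (fst z i) (snd z i) = 0" using eq[OF i] by (simp add: order_antisym)
          moreover have "fst z i \<in> mspace (X i)" "snd z i \<in> mspace (X i)"
            using m i unfolding topT by (auto dest: PiE_mem)
          ultimately show ?thesis by simp
        qed
        then have "fst z = snd z" using m unfolding topT by (intro PiE_ext[of _ I "\<lambda>i. mspace (X i)"])
        moreover have "snd z \<in> mspace D" using m(2) D by (metis topspace_mtopology_of)
        ultimately show "mdist D (fst z) (snd z) < \<epsilon>" using \<epsilon> by (simp add: mdist_self)
      qed
      then obtain J \<sigma> where J: "finite J" "J \<subseteq> I" and \<sigma>: "0 < \<sigma>" and
        close: "\<And>z. z \<in> topspace (prod_topology ?T ?T) \<Longrightarrow>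
          \<forall>i\<in>J. mdist (X i) (fst z i) (snd z i) < \<sigma> \<Longrightarrow> mdist D (fst z) (snd z) < \<epsilon>"
        by (elim exE conjE) blast
      have "\<forall>i\<in>J. \<exists>m :: nat \<times> _ \<times> _. cube_retraction (mtopology_of (X i)) {..<fst m} (fst (snd m)) (snd (snd m)) \<and>
          (\<forall>x\<in>mspace (X i). mdist (X i) (snd (snd m) x) x < \<sigma>)"
      proof
        fix i assume "i \<in> J"
        then have "admits_polyhedral_retractions (X i)" using J adm by blast
        from cube_retraction_polyhedral[OF this \<sigma>] obtain N :: nat and K U R
          where "cube_retraction (mtopology_of (X i)) {..<N} U R \<and> U ` mspace (X i) = ordered_base N K \<and>
            (\<forall>x\<in>mspace (X i). mdist (X i) (R x) x < \<sigma>)"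
          by (elim exE)
        then show "\<exists>m :: nat \<times> _ \<times> _. cube_retraction (mtopology_of (X i)) {..<fst m} (fst (snd m)) (snd (snd m)) \<and>
          (\<forall>x\<in>mspace (X i). mdist (X i) (snd (snd m) x) x < \<sigma>)"
          by (intro exI[of _ "(N, U, R)"]) simp
      qed
      then obtain m :: "'i \<Rightarrow> nat \<times> _ \<times> _" where m: "\<forall>i\<in>J. cube_retraction (mtopology_of (X i)) {..<fst (m i)} (fst (snd (m i))) (snd (snd (m i))) \<and>
          (\<forall>x\<in>mspace (X i). mdist (X i) (snd (snd (m i)) x) x < \<sigma>)"
        by (rule bchoice[THEN exE])
      define N :: "'i \<Rightarrow> nat" and U R where "N = (\<lambda>i. fst (m i))" and "U = (\<lambda>i. fst (snd (m i)))" and "R = (\<lambda>i. snd (snd (m i)))"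
      have cr: "cube_retraction (mtopology_of (X i)) {..<N i} (U i) (R i)" if "i \<in> J" for i
        using m that by (simp add: N_def U_def R_def)
      have near: "mdist (X i) (R i x) x < \<sigma>" if "i \<in> J" "x \<in> mspace (X i)" for i x
        using m that by (simp add: R_def)
      note cr' = cube_retractionD[OF cr, unfolded topspace_mtopology_of]
      define U' where "U' = (\<lambda>x (i, k). if i \<in> J then U i (x i) k else 0)"
      define R' where "R' = (\<lambda>x. \<lambda>i\<in>I. if i \<in> J then R i (x i) else e i)"
      define V where "V = Sigma J (\<lambda>i. {..<N i})"
      have xi: "x i \<in> mspace (X i)" if "x \<in> topspace ?T" "i \<in> I" for x i
        using that unfolding topT by (rule PiE_mem)
      have R'c: "continuous_map ?T ?T R'"
        unfolding continuous_map_componentwise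
      proof (intro conjI ballI)
        show "R' ` topspace ?T \<subseteq> extensional I" by (auto simp: R'_def)
        fix i assume i: "i \<in> I"
        show "continuous_map ?T (mtopology_of (X i)) (\<lambda>x. R' x i)"
        proof (cases "i \<in> J")
          case True
          then show ?thesis
            using continuous_map_compose[OF proj[OF i] cr'(3)[OF True]] i by (simp add: R'_def o_def)
        next
          case False
          then show ?thesis using i xi[OF e i] by (simp add: R'_def)
        qed
      qed
      have R'T: "R' x \<in> topspace ?T" if "x \<in> topspace ?T" for x
        using continuous_map_funspace[OF R'c] that by (rule funcset_mem)
      have R'J: "R' x i = R i (x i)" if "i \<in> J" for x i using that J by (auto simp: R'_def)
      have "cube_retraction ?T V U' R'"
        unfolding cube_retraction_def
      proof (intro conjI ballI allI impI)
        show "finite V" using J by (simp add: V_def)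
        show "continuous_map ?T euclideanreal (\<lambda>x. U' x v)" for v
        proof (cases v)
          case (Pair i k)
          show ?thesis
          proof (cases "i \<in> J")
            case True
            then have "continuous_map ?T euclideanreal (\<lambda>x. U i (x i) k)"
              using continuous_map_compose[OF proj cr'(2)[OF True]] J by (auto simp: o_def)
            then show ?thesis using True by (simp add: U'_def Pair)
          qed (simp add: U'_def Pair)
        qed
        show "continuous_map ?T ?T R'" by (rule R'c)
        show "order_closed (U' ` topspace ?T)"
          unfolding order_closed_def
        proof (intro ballI allI impI)
          fix y and \<psi> :: "real \<Rightarrow> real"
          assume "y \<in> U' ` topspace ?T" and \<psi>: "mono \<psi> \<and> \<psi> 0 = 0 \<and> \<psi> 1 = 1"
          then obtain x where x: "x \<in> topspace ?T" and y: "y = U' x" by blast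
          have "\<forall>i\<in>J. \<exists>x'. x' \<in> mspace (X i) \<and> U i x' = (\<lambda>k. \<psi> (U i (x i) k))"
          proof
            fix i assume i: "i \<in> J"
            have "U i (x i) \<in> U i ` mspace (X i)" using xi[OF x] i J by blast
            then have "(\<lambda>k. \<psi> (U i (x i) k)) \<in> U i ` mspace (X i)"
              using cr'(9)[OF i] \<psi> unfolding order_closed_def by blast
            then show "\<exists>x'. x' \<in> mspace (X i) \<and> U i x' = (\<lambda>k. \<psi> (U i (x i) k))"
              by (metis imageE)
          qed
          then obtain x' where x': "\<forall>i\<in>J. x' i \<in> mspace (X i) \<and> U i (x' i) = (\<lambda>k. \<psi> (U i (x i) k))"
            by (rule bchoice[THEN exE])
          define x'' where "x'' = (\<lambda>i\<in>I. if i \<in> J then x' i else e i)"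
          have "x'' \<in> topspace ?T" unfolding topT x''_def using x' xi[OF e] by auto
          moreover have "(\<lambda>v. \<psi> (y v)) = U' x''"
          proof
            fix v show "\<psi> (y v) = U' x'' v"
              using x' J \<psi> by (cases v) (auto simp: y U'_def x''_def)
          qed
          ultimately show "(\<lambda>v. \<psi> (y v)) \<in> U' ` topspace ?T" by blast
        qed
        fix x assume x: "x \<in> topspace ?T"
        have "0 \<le> U' x v \<and> U' x v \<le> 1 \<and> (v \<notin> V \<longrightarrow> U' x v = 0)" for v
        proof (cases v)
          case (Pair i k)
          show ?thesis
          proof (cases "i \<in> J")
            case True
            then have "x i \<in> mspace (X i)" using xi[OF x] J by blast
            then show ?thesis
              using cr'(4,5,6)[OF True, of "x i" k] True by (simp add: Pair U'_def V_def)
          qed (simp add: Pair U'_def)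
        qed
        then show "0 \<le> U' x v" "U' x v \<le> 1" "v \<notin> V \<Longrightarrow> U' x v = 0" for v by auto
        show "U' (R' x) = U' x"
        proof
          fix v show "U' (R' x) v = U' x v"
          proof (cases v)
            case (Pair i k)
            show ?thesis
            proof (cases "i \<in> J")
              case True
              then have "x i \<in> mspace (X i)" using xi[OF x] J by blast
              then show ?thesis using cr'(8)[OF True] True by (simp add: Pair U'_def R'J)
            qed (simp add: Pair U'_def)
          qed
        qed
        fix y assume y: "y \<in> topspace ?T" and eq: "U' x = U' y"
        have "R i (x i) = R i (y i)" if i: "i \<in> J" for i
        proof (rule cr'(7)[OF i])
          show "x i \<in> mspace (X i)" "y i \<in> mspace (X i)" using xi x y i J by blast+
          show "U i (x i) = U i (y i)"
          proof
            fix k show "U i (x i) k = U i (y i) k"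
              using fun_cong[OF eq, of "(i, k)"] i by (simp add: U'_def)
          qed
        qed
        then show "R' x = R' y" by (auto simp: R'_def)
      qed
      moreover have "mdist D (R' x) x < \<epsilon>" if "x \<in> mspace D" for x
      proof -
        have x: "x \<in> topspace ?T" using that D by (metis topspace_mtopology_of)
        have "\<forall>i\<in>J. mdist (X i) (fst (R' x, x) i) (snd (R' x, x) i) < \<sigma>"
          using near xi[OF x] J by (auto simp: R'J)
        moreover have "(R' x, x) \<in> topspace (prod_topology ?T ?T)" using R'T[OF x] x by simp
        ultimately show ?thesis using close[of "(R' x, x)"] by simp
      qed
      ultimately show ?thesis unfolding D by blast
    qed
  qed
  then show ?thesis using met by (simp add: zero_CR_space_def)
qed

section \<open>Products, cones and suspensions of spaces with polyhedral retractions\<close>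

theorem theorem5p1:
  fixes \<X> :: "'a metric set"
  assumes "\<forall>X\<in>\<X>. compact_space (mtopology_of X)"
    and "\<forall>X\<in>\<X>. admits_polyhedral_retractions X"
  shows "(\<forall>(I :: 'i set) X. countable I \<and> (\<forall>i\<in>I. X i \<in> \<X>) \<longrightarrow>
            zero_CR_space (product_topology (\<lambda>i. mtopology_of (X i)) I)) \<and>
         (\<forall>X\<in>\<X>. zero_CR_space (cone_topology (mtopology_of X)) \<and>
            zero_CR_space (suspension_topology (mtopology_of X)))"
proof (intro conjI allI impI ballI)
  fix I :: "'i set" and X
  assume "countable I \<and> (\<forall>i\<in>I. X i \<in> \<X>)"
  then have I: "countable I" and X: "\<forall>i\<in>I. X i \<in> \<X>" by simp_all
  show "zero_CR_space (product_topology (\<lambda>i. mtopology_of (X i)) I)"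
    by (rule zero_CR_space_product[OF I]) (use assms X in simp_all)
next
  fix X assume "X \<in> \<X>"
  then have "compact_space (mtopology_of X)" "admits_polyhedral_retractions X"
    using assms by simp_all
  then show "zero_CR_space (cone_topology (mtopology_of X))"
    "zero_CR_space (suspension_topology (mtopology_of X))"
    by (rule zero_CR_space_cone, rule zero_CR_space_suspension)
qed

end
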